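(* Let $\mathcal V$ be an algebra of differential functions in $\ell<\infty$ variables which is an extension of $R_\ell=\mathbb F[u_i^{(n)}\mid i\in I,n\in\mathbb Z_+]$. (a) If $K(\partial)$ is an $\ell\times\ell$ matrix differential operator with quasiconstant coefficients, then $(\tilde\Omega^\bullet(\mathcal V),\delta_K)$ is a cohomology complex, i.e. $\delta_K^2=0$. (b) The differential $\delta_K$ commutes with the action of $\partial$ on $\tilde\Omega^\bullet(\mathcal V)$. Moreover, the canonical quotient map $\tilde\Omega^\bullet(\mathcal V)\to\Omega^\bullet(\mathcal V)$ gives a homomorphism of complexes $(\tilde\Omega^\bullet(\mathcal V),\delta_K)\to(\Omega^\bullet(\mathcal V),\delta_K)$.
   Context: $\mathbb F$ is a field of characteristic $0$; $I=\{1,\dots,\ell\}$. A hat over an entry means that it is omitted. An algebra of differential functions in $u_i$, $i\in I$, is a unital commutative associative algebra $\mathcal V$ with a derivation $\partial$ and commuting derivations $\frac{\partial}{\partial u_i^{(n)}}$ such that for each $f$ all but finitely many $\frac{\partial f}{\partial u_i^{(n)}}$ vanish and $[\frac{\partial}{\partial u_i^{(n)}},\partial]=\frac{\partial}{\partial u_i^{(n-1)}}$ ($0$ if $n=0$). In $R_\ell$, $\partial u_i^{(n)}=u_i^{(n+1)}$. Quasiconstants: $\mathcal F=\{f\in\mathcal V:\frac{\partial f}{\partial u_i^{(n)}}=0\ \forall i,n\}$. $\tilde\Omega^k(\mathcal V)$ is the space of arrays $P=(P_{i_1,\dots,i_k}(\lambda_1,\dots,\lambda_k))_{i_1,\dots,i_k\in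 I}$ with entries in $\mathcal V[\lambda_1,\dots,\lambda_k]$, skewsymmetric under simultaneous permutations of the indices and the variables; $\partial$ acts by $(\partial P)_{i_1,\dots,i_k}=(\partial+\lambda_1+\dots+\lambda_k)P_{i_1,\dots,i_k}$; $\Omega^k(\mathcal V)=\tilde\Omega^k(\mathcal V)/\partial\tilde\Omega^k(\mathcal V)$. For $K(\partial)=(K_{ij}(\partial))_{i,j\in I}$ with coefficients in $\mathcal F$ and symbol $K_{ij}(\lambda)$, $\delta_K:\tilde\Omega^k(\mathcal V)\to\tilde\Omega^{k+1}(\mathcal V)$ is $$(\delta_KP)_{i_0,\dots,i_k}(\lambda_0,\dots,\lambda_k)=\sum_{\alpha=0}^k(-1)^\alpha\sum_{j\in I,n\in\mathbb Z_+}\frac{\partial P_{i_0,\dots,\widehat{i_\alpha},\dots,i_k}(\lambda_0,\dots,\widehat{\lambda_\alpha},\dots,\lambda_k)}{\partial u_j^{(n)}}(\lambda_\alpha+\partial)^nK_{j,i_\alpha}(\lambda_\alpha),$$ where $\partial$ acts on the coefficients of $K$. The differential $\delta_K$ on $\Omega^\bullet(\mathcal V)$ is defined by the same formula, with entries taken in $\mathbb F[\lambda_1,\dots,\lambda_k]\otimes\mathcal V$ modulo the image of $\lambda_1+\dots+\lambda_k+\partial$. *)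

theory Defs
  imports
    "HOL-Library.Poly_Mapping"
    "HOL-Computational_Algebra.Polynomial"
    "HOL-Combinatorics.Permutations"
    "HOL-Algebra.Module"
    "HOL-Algebra.AbelCoset"
    "HOL-Algebra.Algebraic_Closure_Type"
begin

section \<open>Algebras of differential functions\<close>

definition derivation :: "('f::field \<Rightarrow> 'v::comm_ring_1 \<Rightarrow> 'v) \<Rightarrow> ('v \<Rightarrow> 'v) \<Rightarrow> bool" where
  "derivation scale d \<longleftrightarrow>
     Vector_Spaces.linear scale scale d \<and> (\<forall>f g. d (f * g) = d f * g + f * d g)"

text \<open>The algebra is the whole type \<^typ>\<open>'v\<close>; \<open>scale\<close> is its scalar multiplication, \<open>D\<close> is
  $\partial$, and \<open>du i n\<close> is $\partial / \partial u_i^{(n)}$, which is only meaningful for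
  $i \in I = \{1, \dots, \ell\}$.\<close>

locale diff_functions =
  fixes l :: nat
    and scale :: "'f::field_char_0 \<Rightarrow> 'v::comm_ring_1 \<Rightarrow> 'v"
    and D :: "'v \<Rightarrow> 'v"
    and du :: "nat \<Rightarrow> nat \<Rightarrow> 'v \<Rightarrow> 'v"
  assumes vector_space_scale: "vector_space scale"
    and scale_mult: "scale c (f * g) = scale c f * g"
    and derivation_D: "derivation scale D"
    and derivation_du: "i \<in> {1..l} \<Longrightarrow> derivation scale (du i n)"
    and du_commute: "i \<in> {1..l} \<Longrightarrow> j \<in> {1..l} \<Longrightarrow> du i n (du j m f) = du j m (du i n f)"
    and finite_du: "finite {(i, n). i \<in> {1..l} \<and> du i n f \<noteq> 0}"
    and du_D: "i \<in> {1..l} \<Longrightarrow>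
      du i n (D f) - D (du i n f) = (case n of 0 \<Rightarrow> 0 | Suc m \<Rightarrow> du i m f)"

text \<open>Multivariate polynomials with variables indexed by \<^typ>\<open>'x\<close> are finitely supported maps
  from monomials (exponent vectors) to coefficients.\<close>

type_synonym ('x, 'a) mpoly = "('x \<Rightarrow>\<^sub>0 nat) \<Rightarrow>\<^sub>0 'a"

definition mpolys_in :: "'x set \<Rightarrow> ('x, 'a::zero) mpoly set" where
  "mpolys_in V = {p. \<forall>m\<in>Poly_Mapping.keys p. Poly_Mapping.keys m \<subseteq> V}"

definition mconst :: "'a::zero \<Rightarrow> ('x, 'a) mpoly" where
  "mconst c = Poly_Mapping.single 0 c"

definition mvar :: "'x \<Rightarrow> ('x, 'a::zero_neq_one) mpoly" where
  "mvar x = Poly_Mapping.single (Poly_Mapping.single x 1) 1"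

definition diff_polys :: "nat \<Rightarrow> (nat \<times> nat, 'f::zero) mpoly set" where
  "diff_polys l = mpolys_in ({1..l} \<times> UNIV)"

text \<open>\<open>\<iota>\<close> embeds $R_\ell = \mathbb F[u_i^{(n)}]$ as a unital subalgebra; the variable \<open>mvar (i, n)\<close> is
  $u_i^{(n)}$. Being derivations, $\partial$ and $\partial / \partial u_i^{(n)}$ extend those of
  $R_\ell$ as soon as they do so on the generators.\<close>

locale diff_functions_extension = diff_functions l scale D du
  for l :: nat
    and scale :: "'f::field_char_0 \<Rightarrow> 'v::comm_ring_1 \<Rightarrow> 'v"
    and D :: "'v \<Rightarrow> 'v"
    and du :: "nat \<Rightarrow> nat \<Rightarrow> 'v \<Rightarrow> 'v" +
  fixes \<iota> :: "(nat \<times> nat, 'f) mpoly \<Rightarrow> 'v"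
  assumes embed_inj: "inj_on \<iota> (diff_polys l)"
    and embed_add: "p \<in> diff_polys l \<Longrightarrow> q \<in> diff_polys l \<Longrightarrow> \<iota> (p + q) = \<iota> p + \<iota> q"
    and embed_mult: "p \<in> diff_polys l \<Longrightarrow> q \<in> diff_polys l \<Longrightarrow> \<iota> (p * q) = \<iota> p * \<iota> q"
    and embed_const: "\<iota> (mconst c) = scale c 1"
    and D_var: "i \<in> {1..l} \<Longrightarrow> D (\<iota> (mvar (i, n))) = \<iota> (mvar (i, Suc n))"
    and du_var: "i \<in> {1..l} \<Longrightarrow> j \<in> {1..l} \<Longrightarrow>
      du i n (\<iota> (mvar (j, m))) = (if i = j \<and> n = m then 1 else 0)"

definition quasiconstants :: "nat \<Rightarrow> (nat \<Rightarrow> nat \<Rightarrow> 'v::zero \<Rightarrow> 'v) \<Rightarrow> 'v set" where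
  "quasiconstants l du = {f. \<forall>i\<in>{1..l}. \<forall>n. du i n f = 0}"


section \<open>Skewsymmetric arrays of polynomials\<close>

text \<open>\<open>msubst \<theta> p\<close> is $p(\theta_0, \theta_1, \dots)$.\<close>

definition msubst ::
  "('x \<Rightarrow> ('y, 'a::comm_ring_1) mpoly) \<Rightarrow> ('x, 'a) mpoly \<Rightarrow> ('y, 'a) mpoly" where
  "msubst \<theta> p = (\<Sum>m\<in>Poly_Mapping.keys p.
     mconst (Poly_Mapping.lookup p m) *
     (\<Prod>x\<in>Poly_Mapping.keys m. \<theta> x ^ Poly_Mapping.lookup m x))"

text \<open>Positions in an array, and the variables $\lambda$, are counted from 0: an entry of a
  \<open>k\<close>-array is \<open>P [i\<^sub>1, \<dots>, i\<^sub>k]\<close>, a polynomial in \<open>mvar 0, \<dots>, mvar (k - 1)\<close>.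
  Arrays are set to 0 outside the genuine multi-indices so that equality of arrays is equality
  of functions.\<close>

type_synonym 'v array = "nat list \<Rightarrow> (nat, 'v) mpoly"

definition multi_indices :: "nat \<Rightarrow> nat \<Rightarrow> nat list set" where
  "multi_indices l k = {is. length is = k \<and> set is \<subseteq> {1..l}}"

definition skew_arrays :: "nat \<Rightarrow> nat \<Rightarrow> 'v::comm_ring_1 array set" where
  "skew_arrays l k = {P.
     (\<forall>is. is \<notin> multi_indices l k \<longrightarrow> P is = 0) \<and>
     (\<forall>is\<in>multi_indices l k. P is \<in> mpolys_in {..<k}) \<and>
     (\<forall>\<sigma>. \<sigma> permutes {..<k} \<longrightarrow> (\<forall>is\<in>multi_indices l k.
        msubst (\<lambda>a. mvar (\<sigma> a)) (P (permute_list \<sigma> is)) = of_int (sign \<sigma>) * P is))}"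

text \<open>$\tilde\Omega^k(\mathcal V)$ as a vector space; the multiplicative fields of the record play
  no role.\<close>

definition Omega_tilde ::
  "nat \<Rightarrow> ('f \<Rightarrow> 'v \<Rightarrow> 'v) \<Rightarrow> nat \<Rightarrow> ('f, 'v::comm_ring_1 array) module" where
  "Omega_tilde l scale k = \<lparr>
     carrier = skew_arrays l k,
     monoid.mult = undefined,
     one = undefined,
     ring.zero = (\<lambda>is. 0),
     add = (\<lambda>P Q is. P is + Q is),
     module.smult = (\<lambda>c P is. Poly_Mapping.map (scale c) (P is)) \<rparr>"

text \<open>$\partial + \lambda_1 + \dots + \lambda_k$\<close>

definition total_D ::
  "('v \<Rightarrow> 'v) \<Rightarrow> nat \<Rightarrow> (nat, 'v::comm_ring_1) mpoly \<Rightarrow> (nat, 'v) mpoly" where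
  "total_D D k p = Poly_Mapping.map D p + (\<Sum>a<k. mvar a) * p"

definition array_D :: "('v \<Rightarrow> 'v) \<Rightarrow> nat \<Rightarrow> 'v::comm_ring_1 array \<Rightarrow> 'v array" where
  "array_D D k P = (\<lambda>is. total_D D k (P is))"

definition omit :: "nat \<Rightarrow> 'a list \<Rightarrow> 'a list" where
  "omit \<alpha> xs = take \<alpha> xs @ drop (Suc \<alpha>) xs"

text \<open>\<open>omit_var \<alpha>\<close> turns $p(\lambda_0, \dots, \lambda_{k-1})$ into
  $p(\lambda_0, \dots, \widehat{\lambda_\alpha}, \dots, \lambda_k)$.\<close>

definition omit_var :: "nat \<Rightarrow> (nat, 'a::comm_ring_1) mpoly \<Rightarrow> (nat, 'a) mpoly" where
  "omit_var \<alpha> = msubst (\<lambda>a. mvar (if a < \<alpha> then a else Suc a))"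

text \<open>$(\lambda_\alpha + \partial)^n L(\lambda_\alpha)$, where the differential operator
  $L(\partial)$ is given by its symbol\<close>

definition shifted_symbol ::
  "('v \<Rightarrow> 'v) \<Rightarrow> nat \<Rightarrow> nat \<Rightarrow> 'v::comm_ring_1 poly \<Rightarrow> (nat, 'v) mpoly" where
  "shifted_symbol D \<alpha> n L =
     ((\<lambda>p. mvar \<alpha> * p + Poly_Mapping.map D p) ^^ n) (poly (map_poly mconst L) (mvar \<alpha>))"

text \<open>The sum over \<open>n\<close> is the finite-support sum \<^const>\<open>Sum_any\<close>: a polynomial has finitely many
  coefficients, each of which is killed by almost all \<open>du j n\<close>. Applying \<open>du j n\<close> to the
  coefficients commutes with renaming the variables.\<close>

definition delta ::
  "nat \<Rightarrow> ('v \<Rightarrow> 'v) \<Rightarrow> (nat \<Rightarrow> nat \<Rightarrow> 'v \<Rightarrow> 'v) \<Rightarrow> (nat \<Rightarrow> nat \<Rightarrow> 'v poly)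
    \<Rightarrow> nat \<Rightarrow> 'v::comm_ring_1 array \<Rightarrow> 'v array" where
  "delta l D du K k P = (\<lambda>is.
     if is \<in> multi_indices l (Suc k) then
       \<Sum>\<alpha>\<le>k. (-1) ^ \<alpha> * (\<Sum>j\<in>{1..l}. Sum_any (\<lambda>n.
         Poly_Mapping.map (du j n) (omit_var \<alpha> (P (omit \<alpha> is)))
           * shifted_symbol D \<alpha> n (K j (is ! \<alpha>))))
     else 0)"


section \<open>The quotient complex\<close>

definition quotient_module :: "('f, 'm) module \<Rightarrow> 'm set \<Rightarrow> ('f, 'm set) module" where
  "quotient_module M H = \<lparr>
     carrier = a_rcosets\<^bsub>M\<^esub> H,
     monoid.mult = undefined,
     one = undefined,
     ring.zero = H,
     add = set_add M,
     module.smult = (\<lambda>c C. \<Union>x\<in>C. H +>\<^bsub>M\<^esub> (c \<odot>\<^bsub>M\<^esub> x)) \<rparr>"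

definition exact_arrays :: "nat \<Rightarrow> ('v \<Rightarrow> 'v) \<Rightarrow> nat \<Rightarrow> 'v::comm_ring_1 array set" where
  "exact_arrays l D k = array_D D k ` skew_arrays l k"

definition Omega ::
  "nat \<Rightarrow> ('f \<Rightarrow> 'v \<Rightarrow> 'v) \<Rightarrow> ('v \<Rightarrow> 'v) \<Rightarrow> nat \<Rightarrow> ('f, 'v::comm_ring_1 array set) module" where
  "Omega l scale D k = quotient_module (Omega_tilde l scale k) (exact_arrays l D k)"

definition Omega_proj ::
  "nat \<Rightarrow> ('f \<Rightarrow> 'v \<Rightarrow> 'v) \<Rightarrow> ('v \<Rightarrow> 'v) \<Rightarrow> nat \<Rightarrow> 'v::comm_ring_1 array \<Rightarrow> 'v array set" where
  "Omega_proj l scale D k P = exact_arrays l D k +>\<^bsub>Omega_tilde l scale k\<^esub> P"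

text \<open>The differential on the quotient: the formula for \<^const>\<open>delta\<close> is applied to
  representatives, and each entry of the result is read modulo the image of
  $\lambda_0 + \dots + \lambda_k + \partial$ on all of $\mathcal V[\lambda_0, \dots, \lambda_k]$.
  Congruence is thus imposed entry by entry, without asking that the differences come from a
  skewsymmetric array.\<close>

definition delta_Omega ::
  "nat \<Rightarrow> ('v \<Rightarrow> 'v) \<Rightarrow> (nat \<Rightarrow> nat \<Rightarrow> 'v \<Rightarrow> 'v) \<Rightarrow> (nat \<Rightarrow> nat \<Rightarrow> 'v poly)
    \<Rightarrow> nat \<Rightarrow> 'v::comm_ring_1 array set \<Rightarrow> 'v array set" where
  "delta_Omega l D du K k \<omega> = {Q \<in> skew_arrays l (Suc k). \<exists>P\<in>\<omega>.
     \<forall>is\<in>multi_indices l (Suc k).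
       Q is - delta l D du K k P is \<in> total_D D (Suc k) ` mpolys_in {..<Suc k}}"


section \<open>Cochain complexes\<close>

definition module_map ::
  "'f ring \<Rightarrow> ('f, 'm) module \<Rightarrow> ('f, 'n) module \<Rightarrow> ('m \<Rightarrow> 'n) \<Rightarrow> bool" where
  "module_map R M N h \<longleftrightarrow>
     h \<in> carrier M \<rightarrow> carrier N \<and>
     (\<forall>x\<in>carrier M. \<forall>y\<in>carrier M. h (x \<oplus>\<^bsub>M\<^esub> y) = h x \<oplus>\<^bsub>N\<^esub> h y) \<and>
     (\<forall>c\<in>carrier R. \<forall>x\<in>carrier M. h (c \<odot>\<^bsub>M\<^esub> x) = c \<odot>\<^bsub>N\<^esub> h x)"

definition cochain_complex ::
  "'f ring \<Rightarrow> (nat \<Rightarrow> ('f, 'm) module) \<Rightarrow> (nat \<Rightarrow> 'm \<Rightarrow> 'm) \<Rightarrow> bool" where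
  "cochain_complex R C d \<longleftrightarrow>
     (\<forall>k. Module.module R (C k)) \<and>
     (\<forall>k. module_map R (C k) (C (Suc k)) (d k)) \<and>
     (\<forall>k. \<forall>x\<in>carrier (C k). d (Suc k) (d k x) = \<zero>\<^bsub>C (Suc (Suc k))\<^esub>)"

definition complex_hom ::
  "'f ring \<Rightarrow> (nat \<Rightarrow> ('f, 'm) module) \<Rightarrow> (nat \<Rightarrow> 'm \<Rightarrow> 'm)
    \<Rightarrow> (nat \<Rightarrow> ('f, 'n) module) \<Rightarrow> (nat \<Rightarrow> 'n \<Rightarrow> 'n) \<Rightarrow> (nat \<Rightarrow> 'm \<Rightarrow> 'n) \<Rightarrow> bool" where
  "complex_hom R C d C' d' \<phi> \<longleftrightarrow>
     cochain_complex R C d \<and> cochain_complex R C' d' \<and>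
     (\<forall>k. module_map R (C k) (C' k) (\<phi> k)) \<and>
     (\<forall>k. \<forall>x\<in>carrier (C k). \<phi> (Suc k) (d k x) = d' k (\<phi> k x))"

end

(* All entries of an array are killed by du j n for n large, so on a given array delta_K is the
   finite alternating sum over alpha of the operators dsum, with
   dsum(p) = sum over j and n < N of (d p / d u_j^(n)) (lambda_alpha + D)^n K_{j,i}(lambda_alpha).
   The coefficients of K are quasiconstant, so any two of these operators commute; this cancels the
   terms of delta_K^2 in pairs, as for the boundary of a simplex.  The commutator relation
   [d/du^(n), D] = d/du^(n-1) shifts n by one, which the factor lambda_alpha of
   (lambda_alpha + D)^(n+1) compensates, so delta_K commutes with the total derivative.
   On V[lambda_0, ..., lambda_k] the total derivative is injective; hence a skewsymmetric array that
   is exact entry by entry is the derivative of a skewsymmetric array, and the differential of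
   Omega is the one induced by delta_K on cosets. *)

theory Submission
  imports Defs
begin

text \<open>The values of \<open>delta\<close> are skewsymmetric because a permutation \<sigma>
  carries the summand that omits position \<alpha> to the one that omits \<sigma> \<alpha>, and
  induces on the remaining positions a permutation whose sign differs from that of \<sigma> by
  (-1)^(\<alpha> + \<sigma> \<alpha>), exactly the ratio of the two alternating signs. Most of the
  combinatorics serves this sign. The bound N is not canonical: it must serve all entries of all
  arrays in one computation, and it grows by one under the total derivative. Injectivity of the
  total derivative rests on the presence of at least one variable. In degree 0 the total derivative
  is D itself, which kills the constants; but the differential only takes values in positive degree,
  and congruence entry by entry is only imposed there.\<close>

abbreviation (input) cmap :: "('a::zero \<Rightarrow> 'b::zero) \<Rightarrow> ('x \<Rightarrow>\<^sub>0 'a) \<Rightarrow> 'x \<Rightarrow>\<^sub>0 'b" where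
  "cmap \<equiv> Poly_Mapping.map"

section \<open>Additive maps between spaces of polynomials\<close>

lemma sum_single_keys:
  "p = (\<Sum>m\<in>Poly_Mapping.keys p. Poly_Mapping.single m (Poly_Mapping.lookup p m))"
  by (rule poly_mapping_eqI)
    (auto simp: lookup_sum lookup_single when_def in_keys_iff)

text \<open>Takes the place of an induction on polynomials: applied once for each factor, it reduces
  a biadditive identity, such as a product rule, to monomials.\<close>

lemma additive_eq_on_singles:
  fixes f g :: "('x \<Rightarrow>\<^sub>0 'a::ab_group_add) \<Rightarrow> 'b::ab_group_add"
  assumes "Modules.additive f" "Modules.additive g"
    and "\<And>m c. f (Poly_Mapping.single m c) = g (Poly_Mapping.single m c)"
  shows "f p = g p"
  by (subst (1 2) sum_single_keys)
    (simp add: additive.sum[OF assms(1)] additive.sum[OF assms(2)] assms(3))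

lemma lookup_cmap:
  "f 0 = 0 \<Longrightarrow> Poly_Mapping.lookup (cmap f p) m = f (Poly_Mapping.lookup p m)"
  by (simp add: Poly_Mapping.map.rep_eq when_def)

lemma keys_cmap_subset: "Poly_Mapping.keys (cmap f p) \<subseteq> Poly_Mapping.keys p"
  by (auto simp: in_keys_iff Poly_Mapping.map.rep_eq when_def)

lemma cmap_zero [simp]: "cmap f 0 = 0"
  by (rule poly_mapping_eqI) (simp add: Poly_Mapping.map.rep_eq)

lemma mconst_one: "mconst 1 = 1"
  by (simp add: mconst_def)

lemma additive_cmap:
  assumes "Modules.additive d"
  shows "Modules.additive (cmap d)"
  by (auto intro!: additive.intro poly_mapping_eqI
      simp: lookup_cmap additive.zero[OF assms] additive.add[OF assms] lookup_add)

lemma additive_mult_left: "Modules.additive (\<lambda>p. (q::'a::ring) * p)"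
  and additive_mult_right: "Modules.additive (\<lambda>p. p * (q::'a::ring))"
  by (auto intro: additive.intro simp: algebra_simps)

lemma additive_compose:
  "Modules.additive f \<Longrightarrow> Modules.additive g \<Longrightarrow> Modules.additive (\<lambda>p. f (g p))"
  by (simp add: additive_def)

lemma additive_plus:
  "Modules.additive f \<Longrightarrow> Modules.additive g \<Longrightarrow> Modules.additive (\<lambda>p. f p + g p)"
  by (simp add: additive_def algebra_simps)

text \<open>The signs of \<open>delta\<close> are powers of -1 in the polynomial ring. An additive
  map that is not multiplicative still preserves negation, hence lets them pass.\<close>

lemma additive_minus_one_power:
  fixes f :: "'a::ring_1 \<Rightarrow> 'b::ring_1"
  assumes "Modules.additive f"
  shows "f ((-1) ^ n * x) = (-1) ^ n * f x"
  by (induction n) (simp_all add: additive.minus[OF assms])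

lemma additive_of_int_sign:
  fixes f :: "'a::ring_1 \<Rightarrow> 'b::ring_1"
  assumes "Modules.additive f"
  shows "f (of_int (sign \<sigma>) * x) = of_int (sign \<sigma>) * f x"
  by (cases \<sigma> rule: sign_cases) (simp_all add: additive.minus[OF assms])


subsection \<open>Renaming variables\<close>

text \<open>The effect of a substitution of variables on an exponent vector. Exponents of variables
  with the same image add up, so that \<open>push f\<close> is a monoid homomorphism for every f,
  injective or not.\<close>

definition push :: "('x \<Rightarrow> 'y) \<Rightarrow> ('x \<Rightarrow>\<^sub>0 nat) \<Rightarrow> 'y \<Rightarrow>\<^sub>0 nat" where
  "push f m = (\<Sum>x\<in>Poly_Mapping.keys m. Poly_Mapping.single (f x) (Poly_Mapping.lookup m x))"

lemma push_superset:
  assumes "finite S" "Poly_Mapping.keys m \<subseteq> S"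
  shows "push f m = (\<Sum>x\<in>S. Poly_Mapping.single (f x) (Poly_Mapping.lookup m x))"
  unfolding push_def by (rule sum.mono_neutral_left) (use assms in \<open>auto simp: in_keys_iff\<close>)

lemma push_single [simp]: "push f (Poly_Mapping.single x n) = Poly_Mapping.single (f x) n"
  by (cases "n = 0") (simp_all add: push_def)

lemma push_zero [simp]: "push f 0 = 0"
  by (simp add: push_def)

lemma push_add: "push f (m + n) = push f m + push f n"
proof -
  let ?S = "Poly_Mapping.keys m \<union> Poly_Mapping.keys n"
  have "Poly_Mapping.keys (m + n) \<subseteq> ?S"
    by (rule keys_add)
  then show ?thesis
    by (simp add: push_superset[of ?S] lookup_add single_add sum.distrib)
qed

lemma push_sum: "push f (sum g A) = (\<Sum>x\<in>A. push f (g x))"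
  by (induction A rule: infinite_finite_induct) (simp_all add: push_add)

lemma push_push: "push f (push g m) = push (f \<circ> g) m"
  by (simp add: push_def[of g] push_def[of "f \<circ> g"] push_sum)

lemma push_cong: "(\<And>x. x \<in> Poly_Mapping.keys m \<Longrightarrow> f x = g x) \<Longrightarrow> push f m = push g m"
  by (simp add: push_def)

lemma keys_push: "Poly_Mapping.keys (push f m) \<subseteq> f ` Poly_Mapping.keys m"
proof -
  have "Poly_Mapping.keys (\<Sum>x\<in>A. Poly_Mapping.single (f x) (Poly_Mapping.lookup m x)) \<subseteq> f ` A"
    if "finite A" for A
    using that
  proof (induction A)
    case (insert a A)
    then show ?case
      using keys_add[of "Poly_Mapping.single (f a) (Poly_Mapping.lookup m a)"
          "\<Sum>x\<in>A. Poly_Mapping.single (f x) (Poly_Mapping.lookup m x)"]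
      by (auto split: if_splits)
  qed simp
  then show ?thesis
    unfolding push_def by simp
qed

text \<open>The substitutions in \<open>skew_arrays\<close> and in \<open>omit_var\<close> are all
  of this form. They move monomials by \<open>push\<close> and leave coefficients alone, unlike a
  general \<open>msubst\<close>.\<close>

definition rename :: "('x \<Rightarrow> 'y) \<Rightarrow> ('x, 'a::comm_ring_1) mpoly \<Rightarrow> ('y, 'a) mpoly" where
  "rename f = msubst (\<lambda>x. mvar (f x))"

lemma mvar_power: "(mvar x :: ('x, 'a::comm_ring_1) mpoly) ^ n = Poly_Mapping.single (Poly_Mapping.single x n) 1"
  by (induction n) (simp_all add: mvar_def mult_single flip: single_add)

lemma prod_single_one:
  "(\<Prod>x\<in>A. Poly_Mapping.single (g x) (1::'a::comm_ring_1)) = Poly_Mapping.single (\<Sum>x\<in>A. g x) 1"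
  by (induction A rule: infinite_finite_induct) (simp_all add: mult_single)

lemma rename_eq_sum:
  "rename f p = (\<Sum>m\<in>Poly_Mapping.keys p. Poly_Mapping.single (push f m) (Poly_Mapping.lookup p m))"
  by (simp add: rename_def msubst_def mvar_power prod_single_one mconst_def mult_single push_def)

text \<open>Cancellation can make the support of a sum smaller than the union of the supports;
  summing over a common superset avoids this.\<close>

lemma rename_superset:
  assumes "finite S" "Poly_Mapping.keys p \<subseteq> S"
  shows "rename f p = (\<Sum>m\<in>S. Poly_Mapping.single (push f m) (Poly_Mapping.lookup p m))"
  unfolding rename_eq_sum
  by (rule sum.mono_neutral_left) (use assms in \<open>auto simp: in_keys_iff\<close>)

lemma additive_rename:
  "Modules.additive (rename f :: ('x, 'a::comm_ring_1) mpoly \<Rightarrow> ('y, 'a) mpoly)"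
proof
  fix p q :: "('x, 'a::comm_ring_1) mpoly"
  let ?S = "Poly_Mapping.keys p \<union> Poly_Mapping.keys q"
  have "Poly_Mapping.keys (p + q) \<subseteq> ?S"
    by (rule keys_add)
  then show "rename f (p + q) = rename f p + rename f q"
    by (simp add: rename_superset[of ?S] lookup_add single_add sum.distrib)
qed

lemmas rename_add = additive.add[OF additive_rename]
  and rename_zero [simp] = additive.zero[OF additive_rename]
  and rename_sum = additive.sum[OF additive_rename]

lemma rename_single [simp]:
  "rename f (Poly_Mapping.single m c) = Poly_Mapping.single (push f m) c"
  by (cases "c = 0") (simp_all add: rename_eq_sum)

lemma rename_mult: "rename f (p * q) = rename f p * rename f q"
proof (rule additive_eq_on_singles[where p = p])
  fix m c
  show "rename f (Poly_Mapping.single m c * q) = rename f (Poly_Mapping.single m c) * rename f q"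
  proof (rule additive_eq_on_singles[where p = q])
    fix n d
    show "rename f (Poly_Mapping.single m c * Poly_Mapping.single n d) =
        rename f (Poly_Mapping.single m c) * rename f (Poly_Mapping.single n d)"
      by (simp add: mult_single push_add)
  qed (rule additive_compose[OF additive_rename additive_mult_left]
      additive_compose[OF additive_mult_left additive_rename])+
qed (rule additive_compose[OF additive_rename additive_mult_right]
    additive_compose[OF additive_mult_right additive_rename])+

lemma rename_rename: "rename f (rename g p) = rename (f \<circ> g) p"
  by (rule additive_eq_on_singles[where p = p], rule additive_compose[OF additive_rename additive_rename],
      rule additive_rename) (simp add: push_push comp_def)

lemma rename_mvar [simp]: "rename f (mvar x) = mvar (f x)"
  by (simp add: mvar_def)

lemma rename_mconst [simp]: "rename f (mconst c) = mconst c"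
  by (simp add: mconst_def)

text \<open>Serves to compare renamings on all of \<open>nat\<close> that are only known to agree on
  the variables of an entry.\<close>

lemma rename_cong:
  assumes "p \<in> mpolys_in V" "\<And>x. x \<in> V \<Longrightarrow> f x = g x"
  shows "rename f p = rename g p"
  unfolding rename_eq_sum
proof (rule sum.cong)
  fix m assume "m \<in> Poly_Mapping.keys p"
  then have "push f m = push g m"
    using assms by (intro push_cong) (auto simp: mpolys_in_def)
  then show "Poly_Mapping.single (push f m) (Poly_Mapping.lookup p m) = Poly_Mapping.single (push g m) (Poly_Mapping.lookup p m)"
    by simp
qed simp

lemma cmap_single [simp]:
  "Modules.additive d \<Longrightarrow> cmap d (Poly_Mapping.single m c) = Poly_Mapping.single m (d c)"
  by (rule poly_mapping_eqI) (simp add: lookup_cmap additive.zero lookup_single when_def)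

text \<open>Renaming may merge monomials, whose coefficients are then added; additivity of d is what
  makes the two operations compatible.\<close>

lemma cmap_rename:
  assumes "Modules.additive d"
  shows "cmap d (rename f p) = rename f (cmap d p)"
  by (rule additive_eq_on_singles[where p = p],
      rule additive_compose[OF additive_cmap[OF assms] additive_rename],
      rule additive_compose[OF additive_rename additive_cmap[OF assms]]) (simp add: assms)


subsection \<open>Polynomials in a set of variables\<close>

lemma mpolys_in_zero [simp]: "0 \<in> mpolys_in V"
  by (simp add: mpolys_in_def)

lemma mpolys_in_single:
  "Poly_Mapping.keys m \<subseteq> V \<Longrightarrow> Poly_Mapping.single m c \<in> mpolys_in V"
  by (simp add: mpolys_in_def)

lemma mpolys_in_mconst [simp]: "mconst c \<in> mpolys_in V"
  by (simp add: mconst_def mpolys_in_single)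

lemma mpolys_in_mvar: "x \<in> V \<Longrightarrow> mvar x \<in> mpolys_in V"
  by (simp add: mvar_def mpolys_in_single)

lemma mpolys_in_add:
  fixes p q :: "('x, 'a::comm_ring_1) mpoly"
  shows "p \<in> mpolys_in V \<Longrightarrow> q \<in> mpolys_in V \<Longrightarrow> p + q \<in> mpolys_in V"
  using keys_add[of p q] by (auto simp: mpolys_in_def)

lemma mpolys_in_sum:
  fixes g :: "'b \<Rightarrow> ('x, 'a::comm_ring_1) mpoly"
  shows "(\<And>x. x \<in> A \<Longrightarrow> g x \<in> mpolys_in V) \<Longrightarrow> sum g A \<in> mpolys_in V"
  by (induction A rule: infinite_finite_induct) (simp_all add: mpolys_in_add)

lemma mpolys_in_mult:
  fixes p q :: "('x, 'a::comm_ring_1) mpoly"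
  assumes "p \<in> mpolys_in V" "q \<in> mpolys_in V"
  shows "p * q \<in> mpolys_in V"
  unfolding mpolys_in_def
proof (intro CollectI ballI)
  fix m assume "m \<in> Poly_Mapping.keys (p * q)"
  then obtain a b where ab: "a \<in> Poly_Mapping.keys p" "b \<in> Poly_Mapping.keys q" "m = a + b"
    using keys_mult[of p q] by auto
  then show "Poly_Mapping.keys m \<subseteq> V"
    using assms keys_add[of a b] by (fastforce simp: mpolys_in_def)
qed

lemma mpolys_in_uminus:
  fixes p :: "('x, 'a::comm_ring_1) mpoly"
  shows "p \<in> mpolys_in V \<Longrightarrow> - p \<in> mpolys_in V"
  by (simp add: mpolys_in_def in_keys_iff)

lemma mpolys_in_minus_one_power: "p \<in> mpolys_in V \<Longrightarrow> (-1) ^ n * p \<in> mpolys_in V"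
  for p :: "('x, 'a::comm_ring_1) mpoly"
  by (induction n) (simp_all add: mpolys_in_uminus)

lemma mpolys_in_cmap: "p \<in> mpolys_in V \<Longrightarrow> cmap f p \<in> mpolys_in V"
  using keys_cmap_subset[of f p] by (auto simp: mpolys_in_def)

lemma mpolys_in_rename:
  fixes p :: "('x, 'a::comm_ring_1) mpoly"
  assumes "p \<in> mpolys_in V" "f ` V \<subseteq> W"
  shows "rename f p \<in> mpolys_in W"
  unfolding rename_eq_sum
proof (intro mpolys_in_sum mpolys_in_single)
  fix m assume "m \<in> Poly_Mapping.keys p"
  then show "Poly_Mapping.keys (push f m) \<subseteq> W"
    using assms keys_push[of f m] by (fastforce simp: mpolys_in_def)
qed

subsection \<open>Coefficientwise derivations\<close>

lemma derivation_additive: "derivation scale d \<Longrightarrow> Modules.additive d"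
  by (simp add: derivation_def additive_def linear_def module_hom_def module_hom_axioms_def
      Vector_Spaces.linear_iff)

lemma derivation_one: "derivation scale d \<Longrightarrow> d 1 = 0"
  unfolding derivation_def by (metis add_cancel_right_left mult.right_neutral mult_1)

text \<open>Both sides are biadditive in p and q. On monomials the exponents simply add, and the
  claim is the product rule for the two coefficients.\<close>

lemma cmap_derivation:
  fixes p q :: "('x, 'v::comm_ring_1) mpoly"
  assumes "derivation scale d"
  shows "cmap d (p * q) = cmap d p * q + p * cmap d q"
proof -
  note a = derivation_additive[OF assms]
  note a' = additive_cmap[OF a] additive_mult_left additive_mult_right
  show ?thesis
  proof (rule additive_eq_on_singles[where p = p])
    fix m :: "'x \<Rightarrow>\<^sub>0 nat" and c :: 'v
    let ?s = "Poly_Mapping.single m c"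
    show "cmap d (?s * q) = cmap d ?s * q + ?s * cmap d q"
    proof (rule additive_eq_on_singles[where p = q])
      fix n e
      show "cmap d (?s * Poly_Mapping.single n e) =
          cmap d ?s * Poly_Mapping.single n e + ?s * cmap d (Poly_Mapping.single n e)"
        using assms by (simp add: a mult_single derivation_def flip: single_add)
    qed (rule additive_plus additive_compose[OF a'(1) a'(2)] additive_compose[OF a'(2) a'(1)] a'(2))+
  qed (rule additive_plus additive_compose[OF a'(1) a'(3)] additive_compose[OF a'(3) a'(1)] a'(3))+
qed

lemma cmap_mvar:
  "derivation scale d \<Longrightarrow> cmap d (mvar x) = 0"
  by (simp add: mvar_def derivation_additive derivation_one)

lemma cmap_mvar_mult:
  fixes p :: "('x, 'v::comm_ring_1) mpoly"
  shows "derivation scale d \<Longrightarrow> cmap d (mvar x * p) = mvar x * cmap d p"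
  by (simp add: cmap_derivation cmap_mvar)


section \<open>Omitted positions, skewsymmetric arrays and shifted symbols\<close>

text \<open>For g = \<open>mvar\<close> this splits the sum of all \<lambda> into the variables of a
  renamed entry and the omitted variable.\<close>

lemma sum_omit:
  fixes g :: "nat \<Rightarrow> 'a::ab_group_add"
  assumes "\<alpha> \<le> k"
  shows "(\<Sum>a<k. g (if a < \<alpha> then a else Suc a)) + g \<alpha> = (\<Sum>a<Suc k. g a)"
  using assms
proof (induction k)
  case (Suc k)
  show ?case
  proof (cases "\<alpha> = Suc k")
    case False
    then have "(\<Sum>a<Suc k. g (if a < \<alpha> then a else Suc a)) + g \<alpha> =
        ((\<Sum>a<k. g (if a < \<alpha> then a else Suc a)) + g \<alpha>) + g (Suc k)"
      using Suc.prems by (simp add: algebra_simps)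
    also have "\<dots> = (\<Sum>a<Suc (Suc k). g a)"
      using Suc False by simp
    finally show ?thesis .
  qed simp
qed simp

text \<open>The increasing injection whose image misses \<alpha>, that is, the coface map of
  simplicial algebra.\<close>

definition skip :: "nat \<Rightarrow> nat \<Rightarrow> nat" where
  "skip \<alpha> a = (if a < \<alpha> then a else Suc a)"

lemma omit_var_eq_rename: "omit_var \<alpha> = rename (skip \<alpha>)"
  by (simp add: fun_eq_iff omit_var_def rename_def skip_def[abs_def])

lemma length_omit: "\<alpha> < length xs \<Longrightarrow> length (omit \<alpha> xs) = length xs - 1"
  by (simp add: omit_def)

lemma nth_omit: "\<alpha> < length xs \<Longrightarrow> a < length xs - 1 \<Longrightarrow> omit \<alpha> xs ! a = xs ! skip \<alpha> a"
  by (auto simp: omit_def skip_def nth_append)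

lemma omit_in_multi_indices:
  "is \<in> multi_indices l (Suc k) \<Longrightarrow> \<alpha> \<le> k \<Longrightarrow> omit \<alpha> is \<in> multi_indices l k"
  using set_take_subset[of \<alpha> "is"] set_drop_subset[of "Suc \<alpha>" "is"]
  by (auto simp: multi_indices_def length_omit omit_def)

lemma nth_in_range: "is \<in> multi_indices l k \<Longrightarrow> a < k \<Longrightarrow> is ! a \<in> {1..l}"
  using nth_mem[of a "is"] unfolding multi_indices_def by blast

lemma finite_multi_indices: "finite (multi_indices l k)"
  using finite_lists_length_eq[of "{1..l}" k] by (simp add: multi_indices_def conj_commute)

lemma skew_arraysI:
  assumes "\<And>is. is \<notin> multi_indices l k \<Longrightarrow> P is = 0"
    and "\<And>is. is \<in> multi_indices l k \<Longrightarrow> P is \<in> mpolys_in {..<k}"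
    and "\<And>\<sigma> is. \<sigma> permutes {..<k} \<Longrightarrow> is \<in> multi_indices l k \<Longrightarrow>
      rename \<sigma> (P (permute_list \<sigma> is)) = of_int (sign \<sigma>) * P is"
  shows "P \<in> skew_arrays l k"
  using assms by (simp add: skew_arrays_def rename_def)

text \<open>\<open>skew_arrays_in\<close> holds for every list, because entries outside the
  multi-indices are 0.\<close>

lemma skew_arraysD:
  assumes "P \<in> skew_arrays l k"
  shows skew_arrays_outside: "is \<notin> multi_indices l k \<Longrightarrow> P is = 0"
    and skew_arrays_in: "P is \<in> mpolys_in {..<k}"
    and skew_arrays_skew: "\<sigma> permutes {..<k} \<Longrightarrow> is \<in> multi_indices l k \<Longrightarrow>
      rename \<sigma> (P (permute_list \<sigma> is)) = of_int (sign \<sigma>) * P is"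
  using assms by (auto simp: skew_arrays_def rename_def) 

lemma shifted_symbol_0:
  "shifted_symbol D \<alpha> 0 L = poly (map_poly mconst L) (mvar \<alpha>)"
  by (simp add: shifted_symbol_def)

lemma shifted_symbol_Suc:
  "shifted_symbol D \<alpha> (Suc n) L =
    mvar \<alpha> * shifted_symbol D \<alpha> n L + cmap D (shifted_symbol D \<alpha> n L)"
  by (simp add: shifted_symbol_def)

lemma poly_mconst_pCons:
  "poly (map_poly mconst (pCons c L)) x = mconst c + x * poly (map_poly mconst L) x"
  by (simp add: map_poly_pCons mconst_def)

lemma shifted_symbol_in: "\<alpha> \<in> V \<Longrightarrow> shifted_symbol D \<alpha> n L \<in> mpolys_in V"
proof (induction n)
  case 0
  show ?case
    unfolding shifted_symbol_0
    by (induction L) (simp_all add: poly_mconst_pCons mpolys_in_add mpolys_in_mult mpolys_in_mvar 0)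
next
  case (Suc n)
  then show ?case
    by (simp add: shifted_symbol_Suc mpolys_in_add mpolys_in_mult mpolys_in_mvar mpolys_in_cmap)
qed

lemma rename_shifted_symbol:
  assumes "Modules.additive D"
  shows "rename f (shifted_symbol D \<alpha> n L) = shifted_symbol D (f \<alpha>) n L"
proof (induction n)
  case 0
  show ?case
    unfolding shifted_symbol_0
    by (induction L) (simp_all add: poly_mconst_pCons rename_add rename_mult)
next
  case (Suc n)
  then show ?case
    by (simp add: shifted_symbol_Suc rename_add rename_mult flip: cmap_rename[OF assms])
qed

lemma additive_total_D: "Modules.additive D \<Longrightarrow> Modules.additive (total_D D k)"
  unfolding total_D_def [abs_def]
  by (intro additive_plus additive_cmap additive_mult_left)

lemma total_D_in: "p \<in> mpolys_in {..<k} \<Longrightarrow> total_D D k p \<in> mpolys_in {..<k}"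
  unfolding total_D_def
  by (intro mpolys_in_add mpolys_in_cmap mpolys_in_mult mpolys_in_sum mpolys_in_mvar) auto

text \<open>A permutation of the variables fixes their sum. Hence \<open>array_D\<close> preserves
  skewsymmetry.\<close>

lemma rename_total_D:
  assumes "Modules.additive D" "\<sigma> permutes {..<k}"
  shows "rename \<sigma> (total_D D k p) = total_D D k (rename \<sigma> p)"
proof -
  have "(\<Sum>a<k. mvar (\<sigma> a)) = (\<Sum>a<k. (mvar a :: (nat, 'a) mpoly))"
    by (rule sum.reindex_bij_betw) (rule permutes_imp_bij[OF assms(2)])
  then show ?thesis
    by (simp add: total_D_def rename_add rename_mult rename_sum cmap_rename[OF assms(1)])
qed

section \<open>Differential operators with quasiconstant coefficients\<close>

locale quasiconstant_operator = diff_functions l scale D du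
  for l :: nat
    and scale :: "'f::field_char_0 \<Rightarrow> 'v::comm_ring_1 \<Rightarrow> 'v"
    and D :: "'v \<Rightarrow> 'v"
    and du :: "nat \<Rightarrow> nat \<Rightarrow> 'v \<Rightarrow> 'v" +
  fixes K :: "nat \<Rightarrow> nat \<Rightarrow> 'v poly"
  assumes coeff_K: "i \<in> {1..l} \<Longrightarrow> j \<in> {1..l} \<Longrightarrow> coeff (K i j) m \<in> quasiconstants l du"
begin

lemmas additive_D = derivation_additive[OF derivation_D]
lemmas additive_du = derivation_additive[OF derivation_du]
lemmas cmap_du_sum = additive.sum[OF additive_cmap[OF additive_du]]
lemmas total_D_sum = additive.sum[OF additive_total_D[OF additive_D]]

lemma cmap_du_D:
  assumes "i \<in> {1..l}"
  shows "cmap (du i n) (cmap D p) =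
    cmap D (cmap (du i n) p) + (case n of 0 \<Rightarrow> 0 | Suc m \<Rightarrow> cmap (du i m) p)"
proof (rule poly_mapping_eqI)
  fix m
  have "du i n (D f) = D (du i n f) + (case n of 0 \<Rightarrow> 0 | Suc m \<Rightarrow> du i m f)" for f
    using du_D[OF assms, of n f] by (simp add: algebra_simps)
  then show "Poly_Mapping.lookup (cmap (du i n) (cmap D p)) m = Poly_Mapping.lookup
      (cmap D (cmap (du i n) p) + (case n of 0 \<Rightarrow> 0 | Suc m \<Rightarrow> cmap (du i m) p)) m"
    by (simp add: lookup_add lookup_cmap additive.zero[OF additive_D]
        additive.zero[OF additive_du[OF assms]] split: nat.split)
qed

lemma cmap_du_mvar_sum_mult:
  assumes "i \<in> {1..l}"
  shows "cmap (du i n) ((\<Sum>a\<in>A. mvar (g a)) * p) = (\<Sum>a\<in>A. mvar (g a)) * cmap (du i n) p"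
proof -
  have "cmap (du i n) (\<Sum>a\<in>A. mvar (g a)) = 0"
    by (simp add: cmap_du_sum[OF assms] cmap_mvar[OF derivation_du[OF assms]])
  then show ?thesis
    by (simp add: cmap_derivation[OF derivation_du[OF assms]])
qed

lemma cmap_du_commute:
  "i \<in> {1..l} \<Longrightarrow> j \<in> {1..l} \<Longrightarrow>
    cmap (du i n) (cmap (du j m) p) = cmap (du j m) (cmap (du i n) p)"
  by (rule poly_mapping_eqI)
    (simp add: lookup_cmap additive.zero[OF additive_du] du_commute)

text \<open>Commuting \<open>du i m\<close> with D leaves a term with \<open>du i (m - 1)\<close>,
  so the induction on n carries the claim for all m at once. In effect D preserves
  quasiconstants.\<close>

lemma cmap_du_shifted_symbol:
  assumes "i \<in> {1..l}" "j \<in> {1..l}" "j' \<in> {1..l}"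
  shows "cmap (du i m) (shifted_symbol D \<alpha> n (K j j')) = 0"
proof (induction n arbitrary: m)
  case 0
  have "cmap (du i m) (poly (map_poly mconst L) (mvar \<alpha>)) = 0"
    if "\<And>m. coeff L m \<in> quasiconstants l du" for L
    using that
  proof (induction L)
    case (pCons c L)
    have "c \<in> quasiconstants l du"
      using pCons.prems[of 0] by simp
    then have "cmap (du i m) (mconst c) = 0"
      using assms by (simp add: mconst_def additive_du quasiconstants_def)
    moreover have "coeff L m \<in> quasiconstants l du" for m
      using pCons.prems[of "Suc m"] by simp
    ultimately show ?case
      using assms pCons.IH
      by (simp add: poly_mconst_pCons additive.add[OF additive_cmap[OF additive_du]]
          cmap_mvar_mult[OF derivation_du])
  qed simp
  then show ?case
    by (simp only: shifted_symbol_0 coeff_K[OF assms(2,3)])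
next
  case (Suc n)
  then show ?case
    using assms
    by (simp add: shifted_symbol_Suc additive.add[OF additive_cmap[OF additive_du]]
        cmap_mvar_mult[OF derivation_du] cmap_du_D split: nat.split)
qed


section \<open>Bounds for the order of the derivatives\<close>

text \<open>One bound for all i; it turns the finite-support sum in \<open>delta\<close> into a sum
  over n < N, through which additive maps can be moved.\<close>

definition du_vanish :: "nat \<Rightarrow> (nat, 'v) mpoly \<Rightarrow> bool" where
  "du_vanish N p \<longleftrightarrow> (\<forall>i\<in>{1..l}. \<forall>n\<ge>N. cmap (du i n) p = 0)"

lemma du_vanish_mono: "du_vanish M p \<Longrightarrow> M \<le> N \<Longrightarrow> du_vanish N p"
  by (auto simp: du_vanish_def)

lemma du_vanish_add: "du_vanish N p \<Longrightarrow> du_vanish N q \<Longrightarrow> du_vanish N (p + q)"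
  by (simp add: du_vanish_def additive.add[OF additive_cmap[OF additive_du]])

lemma du_vanish_ex: "\<exists>N. du_vanish N p"
proof -
  let ?A = "\<Union>m\<in>Poly_Mapping.keys p. {(i, n). i \<in> {1..l} \<and> du i n (Poly_Mapping.lookup p m) \<noteq> 0}"
  have "finite (snd ` ?A)"
    by (intro finite_imageI finite_UN_I finite_du finite_keys)
  then obtain N where N: "\<forall>n\<in>snd ` ?A. n < N"
    unfolding finite_nat_set_iff_bounded by blast
  have "du_vanish N p"
    unfolding du_vanish_def
  proof (intro ballI allI impI)
    fix i n assume i: "i \<in> {1..l}" and n: "N \<le> n"
    have "du i n (Poly_Mapping.lookup p m) = 0" if "m \<in> Poly_Mapping.keys p" for m
    proof (rule ccontr)
      assume "du i n (Poly_Mapping.lookup p m) \<noteq> 0"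
      then have "(i, n) \<in> ?A"
        using i that by blast
      then show False
        using N n by force
    qed
    then show "cmap (du i n) p = 0"
      by (simp add: map_eq_zero_iff)
  qed
  then show ?thesis ..
qed

lemma du_vanish_array:
  assumes "P \<in> skew_arrays l k"
  obtains N where "\<And>is. du_vanish N (P is)"
proof -
  have "\<forall>is. \<exists>N. du_vanish N (P is)"
    by (simp add: du_vanish_ex)
  then obtain f where f: "\<And>is. du_vanish (f is) (P is)"
    by metis
  \<comment> \<open>There is no multi-index when l = 0 < k; the 0 keeps the maximum meaningful in
    that case.\<close>
  have "du_vanish (Max (insert 0 (f ` multi_indices l k))) (P is)" for "is"
  proof (cases "is \<in> multi_indices l k")
    case True
    then show ?thesis
      by (intro du_vanish_mono[OF f]) (simp add: finite_multi_indices)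
  next
    case False
    then show ?thesis
      by (simp add: skew_arrays_outside[OF assms] du_vanish_def)
  qed
  then show ?thesis
    using that by blast
qed

text \<open>The commutator contributes \<open>du i (n - 1)\<close>, which is only known to vanish
  from n = N + 1 on.\<close>

lemma du_vanish_total_D:
  assumes "du_vanish N p"
  shows "du_vanish (Suc N) (total_D D k p)"
  unfolding du_vanish_def
proof (intro ballI allI impI)
  fix i n assume i: "i \<in> {1..l}" and n: "Suc N \<le> n"
  then obtain m where m: "n = Suc m" "N \<le> m"
    by (cases n) auto
  then have "cmap (du i m) p = 0" "cmap (du i n) p = 0"
    using assms i by (auto simp: du_vanish_def)
  then show "cmap (du i n) (total_D D k p) = 0"
    unfolding total_D_def additive.add[OF additive_cmap[OF additive_du[OF i]]]
      cmap_du_D[OF i] cmap_du_mvar_sum_mult[OF i] by (simp add: m)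
qed


section \<open>The summands of the differential\<close>

text \<open>For N large this is the symbol, in the variable numbered \<alpha>, of the Frechet
  derivative of p composed with column i of K. The variable and the column are separate arguments
  because a renaming moves the first and not the second.\<close>

definition dsum :: "nat \<Rightarrow> nat \<Rightarrow> nat \<Rightarrow> (nat, 'v) mpoly \<Rightarrow> (nat, 'v) mpoly" where
  "dsum N \<alpha> i p =
    (\<Sum>j\<in>{1..l}. \<Sum>n<N. cmap (du j n) p * shifted_symbol D \<alpha> n (K j i))"

lemma additive_dsum: "Modules.additive (dsum N \<alpha> i)"
  by (auto intro!: additive.intro
      simp: dsum_def additive.add[OF additive_cmap[OF additive_du]] algebra_simps sum.distrib)

lemma dsum_in:
  "\<alpha> \<in> V \<Longrightarrow> p \<in> mpolys_in V \<Longrightarrow> dsum N \<alpha> i p \<in> mpolys_in V"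
  unfolding dsum_def
  by (intro mpolys_in_sum mpolys_in_mult mpolys_in_cmap shifted_symbol_in)

lemma rename_dsum: "rename f (dsum N \<alpha> i p) = dsum N (f \<alpha>) i (rename f p)"
  by (simp add: dsum_def rename_sum rename_mult rename_shifted_symbol[OF additive_D]
      cmap_rename[OF additive_du])

text \<open>Any common bound will do, so one N can be shared by several arrays, and both sides of an
  identity can be brought to comparable bounds.\<close>

lemma delta_eq:
  assumes "\<And>is. du_vanish N (P is)" "is \<in> multi_indices l (Suc k)"
  shows "delta l D du K k P is =
    (\<Sum>\<alpha>\<le>k. (-1) ^ \<alpha> * dsum N \<alpha> (is ! \<alpha>) (rename (skip \<alpha>) (P (omit \<alpha> is))))"
proof -
  have "Sum_any (\<lambda>n. cmap (du j n) (rename (skip \<alpha>) (P (omit \<alpha> is))) *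
      shifted_symbol D \<alpha> n (K j (is ! \<alpha>))) =
    (\<Sum>n<N. cmap (du j n) (rename (skip \<alpha>) (P (omit \<alpha> is))) * shifted_symbol D \<alpha> n (K j (is ! \<alpha>)))"
    if "j \<in> {1..l}" for j \<alpha>
  proof (rule Sum_any.expand_superset)
    have "cmap (du j n) (rename (skip \<alpha>) (P (omit \<alpha> is))) = 0" if "N \<le> n" for n
      using assms(1)[of "omit \<alpha> is"] that \<open>j \<in> {1..l}\<close>
      by (simp add: cmap_rename[OF additive_du] du_vanish_def)
    then have "n < N" if "cmap (du j n) (rename (skip \<alpha>) (P (omit \<alpha> is))) *
        shifted_symbol D \<alpha> n (K j (is ! \<alpha>)) \<noteq> 0" for n
      using that by (cases "n < N") simp_all
    then show "{n. cmap (du j n) (rename (skip \<alpha>) (P (omit \<alpha> is))) *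
        shifted_symbol D \<alpha> n (K j (is ! \<alpha>)) \<noteq> 0} \<subseteq> {..<N}"
      by blast
  qed simp
  then have "(\<Sum>j\<in>{1..l}. Sum_any (\<lambda>n. cmap (du j n) (rename (skip \<alpha>) (P (omit \<alpha> is))) *
      shifted_symbol D \<alpha> n (K j (is ! \<alpha>)))) =
    dsum N \<alpha> (is ! \<alpha>) (rename (skip \<alpha>) (P (omit \<alpha> is)))" for \<alpha>
    unfolding dsum_def by (rule sum.cong[OF refl])
  then show ?thesis
    by (simp only: delta_def omit_var_eq_rename if_True assms(2))
qed

lemma delta_outside: "is \<notin> multi_indices l (Suc k) \<Longrightarrow> delta l D du K k P is = 0"
  by (simp add: delta_def)

text \<open>The entry on the left only sees \<Lambda>, the sum of the variables other than that at
  \<alpha>, while the right side involves all of them. The missing variable, together with D acting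
  on the symbol, raises the index of the symbol by one and so matches the commutator terms.\<close>

lemma total_D_dsum:
  assumes "du_vanish N p" "\<alpha> \<le> k" "i \<in> {1..l}"
  shows "dsum (Suc N) \<alpha> i (rename (skip \<alpha>) (total_D D k p)) =
    total_D D (Suc k) (dsum N \<alpha> i (rename (skip \<alpha>) p))"
proof -
  define q where "q = rename (skip \<alpha>) p"
  define \<Lambda> where "\<Lambda> = (\<Sum>a<k. mvar (skip \<alpha> a) :: (nat, 'v) mpoly)"
  have \<Lambda>: "(\<Sum>a<Suc k. mvar a) = \<Lambda> + mvar \<alpha>"
    using sum_omit[OF assms(2), of "mvar :: nat \<Rightarrow> (nat, 'v) mpoly"]
    by (simp add: \<Lambda>_def skip_def)
  have r: "rename (skip \<alpha>) (total_D D k p) = cmap D q + \<Lambda> * q"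
    by (simp add: total_D_def rename_add rename_mult rename_sum q_def \<Lambda>_def cmap_rename[OF additive_D])
  have "(\<Sum>n<Suc N. cmap (du j n) (cmap D q + \<Lambda> * q) * shifted_symbol D \<alpha> n (K j i)) =
      (\<Sum>n<N. total_D D (Suc k) (cmap (du j n) q * shifted_symbol D \<alpha> n (K j i)))"
    (is "?l = ?r") if j: "j \<in> {1..l}" for j
  proof -
    let ?S = "\<lambda>n. shifted_symbol D \<alpha> n (K j i)"
    let ?d = "\<lambda>n. cmap (du j n) q"
    \<comment> \<open>The bound N + 1 on the left produces one summand too many outside the
      commutator terms; it vanishes.\<close>
    have N: "?d N = 0"
      using assms(1) j by (simp add: q_def cmap_rename[OF additive_du] du_vanish_def)
    have "cmap (du j n) (cmap D q + \<Lambda> * q) =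
        (cmap D (?d n) + \<Lambda> * ?d n) + (case n of 0 \<Rightarrow> 0 | Suc m \<Rightarrow> ?d m)" for n
      unfolding \<Lambda>_def additive.add[OF additive_cmap[OF additive_du[OF j]]]
        cmap_du_D[OF j] cmap_du_mvar_sum_mult[OF j] by (simp add: algebra_simps)
    then have "?l = (\<Sum>n<Suc N. (cmap D (?d n) + \<Lambda> * ?d n) * ?S n) +
        (\<Sum>n<Suc N. (case n of 0 \<Rightarrow> 0 | Suc m \<Rightarrow> ?d m) * ?S n)"
      by (simp only: distrib_right sum.distrib)
    \<comment> \<open>There is no commutator term at n = 0, so shifting the index by one brings the
      range back to n < N.\<close>
    also have "(\<Sum>n<Suc N. (case n of 0 \<Rightarrow> 0 | Suc m \<Rightarrow> ?d m) * ?S n) = (\<Sum>n<N. ?d n * ?S (Suc n))"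
      by (subst sum.lessThan_Suc_shift) simp
    also have "(\<Sum>n<Suc N. (cmap D (?d n) + \<Lambda> * ?d n) * ?S n) =
        (\<Sum>n<N. (cmap D (?d n) + \<Lambda> * ?d n) * ?S n)"
      by (simp add: N)
    \<comment> \<open>With d and S as abbreviated above, the product rule leaves d n *
      (\<open>mvar \<alpha>\<close> * S n + D (S n)) = d n * S (n + 1) on the right.\<close>
    also have "\<dots> + (\<Sum>n<N. ?d n * ?S (Suc n)) = ?r"
      unfolding sum.distrib[symmetric]
      by (rule sum.cong)
        (simp_all add: total_D_def \<Lambda> cmap_derivation[OF derivation_D] shifted_symbol_Suc algebra_simps
          del: sum.lessThan_Suc)
    finally show ?thesis .
  qed
  then show ?thesis
    unfolding r q_def[symmetric] dsum_def total_D_sum by (rule sum.cong[OF refl])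
qed

lemma delta_array_D:
  assumes "P \<in> skew_arrays l k"
  shows "delta l D du K k (array_D D k P) = array_D D (Suc k) (delta l D du K k P)"
proof
  fix "is"
  obtain N where N: "\<And>is. du_vanish N (P is)"
    using du_vanish_array[OF assms] by blast
  then have N': "du_vanish (Suc N) (array_D D k P is)" for "is"
    by (simp add: array_D_def du_vanish_total_D)
  show "delta l D du K k (array_D D k P) is = array_D D (Suc k) (delta l D du K k P) is"
  proof (cases "is \<in> multi_indices l (Suc k)")
    case True
    then show ?thesis
      by (simp add: array_D_def delta_eq[OF N True] delta_eq[OF N' True, unfolded array_D_def] total_D_sum
          additive_minus_one_power[OF additive_total_D[OF additive_D]])
        (intro sum.cong refl arg_cong2[of _ _ _ _ "(*)"] total_D_dsum[OF N] nth_in_range[OF True], auto)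
  next
    case False
    then show ?thesis
      by (simp add: array_D_def delta_outside additive.zero[OF additive_total_D[OF additive_D]])
  qed
qed

end


subsection \<open>Deleting a position from a permutation\<close>

text \<open>The cycle \<open>(k, \<alpha>, \<alpha> + 1, \<dots>, k - 1)\<close>, extending \<open>skip \<alpha>\<close> on \<open>{..<k}\<close> to a
  permutation of \<open>{..k}\<close>.\<close>

definition skip_cycle :: "nat \<Rightarrow> nat \<Rightarrow> nat \<Rightarrow> nat" where
  "skip_cycle k \<alpha> a = (if a < k then skip \<alpha> a else if a = k then \<alpha> else a)"

lemma skip_cycle_self: "skip_cycle k k = id"
  by (auto simp: skip_cycle_def skip_def)

lemma skip_cycle_step:
  "\<alpha> < k \<Longrightarrow> skip_cycle k \<alpha> = transpose \<alpha> (Suc \<alpha>) \<circ> skip_cycle k (Suc \<alpha>)"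
  by (auto simp: skip_cycle_def skip_def transpose_def fun_eq_iff)

text \<open>Descending from \<alpha> = k, where the cycle is the identity, each step adds one
  adjacent transposition; there are k - \<alpha> of them.\<close>

lemma skip_cycle_permutes_sign:
  assumes "\<alpha> \<le> k"
  shows "skip_cycle k \<alpha> permutes {..<Suc k} \<and> sign (skip_cycle k \<alpha>) = (-1) ^ (k - \<alpha>)"
  using assms
proof (induction rule: inc_induct)
  case base
  show ?case
    using permutes_id[of "{..<Suc k}"] by (simp add: skip_cycle_self id_def)
next
  case (step \<alpha>)
  have t: "transpose \<alpha> (Suc \<alpha>) permutes {..<Suc k}"
    using step by (intro permutes_swap_id) auto
  have "k - \<alpha> = Suc (k - Suc \<alpha>)"
    using step by simp
  then have "sign (skip_cycle k \<alpha>) = (-1) ^ (k - \<alpha>)"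
    using step.IH permutes_imp_permutation[OF _ t] permutes_imp_permutation[OF _ conjunct1[OF step.IH]]
    by (simp add: skip_cycle_step[OF step.hyps(2)] sign_compose sign_swap_id)
  moreover have "skip_cycle k \<alpha> permutes {..<Suc k}"
    unfolding skip_cycle_step[OF step.hyps(2)] using step.IH t by (blast intro: permutes_compose)
  ultimately show ?case
    by blast
qed

lemmas skip_cycle_permutes = skip_cycle_permutes_sign[THEN conjunct1]
  and sign_skip_cycle = skip_cycle_permutes_sign[THEN conjunct2]

text \<open>The bijection induced by \<sigma> from the positions other than \<alpha> to those other
  than \<sigma> \<alpha>, renumbered on both sides. Renumbering by full permutations rather than by
  \<open>skip\<close> makes the sign multiplicative.\<close>

definition perm_omit :: "nat \<Rightarrow> (nat \<Rightarrow> nat) \<Rightarrow> nat \<Rightarrow> nat \<Rightarrow> nat" where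
  "perm_omit k \<sigma> \<alpha> = inv_into UNIV (skip_cycle k (\<sigma> \<alpha>)) \<circ> (\<sigma> \<circ> skip_cycle k \<alpha>)"

context
  fixes k \<alpha> :: nat and \<sigma> :: "nat \<Rightarrow> nat"
  assumes \<sigma>: "\<sigma> permutes {..<Suc k}" and \<alpha>: "\<alpha> \<le> k"
begin

lemma perm_image_le: "\<sigma> \<alpha> \<le> k"
  using permutes_in_image[OF \<sigma>, of \<alpha>] \<alpha> by auto

lemma skip_cycle_perm_omit:
  "skip_cycle k (\<sigma> \<alpha>) (perm_omit k \<sigma> \<alpha> a) = \<sigma> (skip_cycle k \<alpha> a)"
  by (simp add: perm_omit_def permutes_inverses(1)[OF skip_cycle_permutes[OF perm_image_le]])

text \<open>The extra point k goes to \<alpha>, then to \<sigma> \<alpha>, then back to k.\<close>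

lemma perm_omit_permutes: "perm_omit k \<sigma> \<alpha> permutes {..<k}"
proof (rule permutes_superset)
  show "perm_omit k \<sigma> \<alpha> permutes {..<Suc k}"
    unfolding perm_omit_def
    by (intro permutes_compose permutes_inv \<sigma> skip_cycle_permutes \<alpha> perm_image_le)
  have "skip_cycle k (\<sigma> \<alpha>) (perm_omit k \<sigma> \<alpha> k) = skip_cycle k (\<sigma> \<alpha>) k"
    by (simp add: skip_cycle_perm_omit) (simp add: skip_cycle_def)
  then have "perm_omit k \<sigma> \<alpha> k = k"
    using permutes_inj[OF skip_cycle_permutes[OF perm_image_le]] by (simp add: inj_eq)
  then show "perm_omit k \<sigma> \<alpha> a = a" if "a \<in> {..<Suc k} - {..<k}" for a
    using that by (auto simp: less_Suc_eq)
qed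

lemma skip_perm_omit:
  assumes "a < k"
  shows "skip (\<sigma> \<alpha>) (perm_omit k \<sigma> \<alpha> a) = \<sigma> (skip \<alpha> a)"
  using skip_cycle_perm_omit[of a] permutes_in_image[OF perm_omit_permutes, of a] assms
  by (simp add: skip_cycle_def)

text \<open>The cofactor sign of the Laplace expansion: the two cycles contribute (-1)^(k -
  \<alpha>) and (-1)^(k - \<sigma> \<alpha>), from which k drops out.\<close>

lemma sign_perm_omit: "(-1) ^ \<alpha> * sign (perm_omit k \<sigma> \<alpha>) = sign \<sigma> * (-1) ^ \<sigma> \<alpha>"
proof -
  let ?c = "skip_cycle k"
  have p: "permutation (?c \<alpha>)" "permutation (?c (\<sigma> \<alpha>))" "permutation \<sigma>"
    using \<sigma> skip_cycle_permutes[OF \<alpha>] skip_cycle_permutes[OF perm_image_le]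
    by (auto intro: permutes_imp_permutation[rotated])
  have "sign (perm_omit k \<sigma> \<alpha>) = (-1) ^ (k - \<sigma> \<alpha>) * (sign \<sigma> * (-1) ^ (k - \<alpha>))"
    using p by (simp add: perm_omit_def sign_compose permutation_inverse permutation_compose
        sign_inverse sign_skip_cycle \<alpha> perm_image_le)
  moreover have "(-1) ^ (k - a) = ((-1) ^ k * (-1) ^ a :: int)" if "a \<le> k" for a
    using that by (auto simp: minus_one_power_iff)
  ultimately have "(-1) ^ \<alpha> * sign (perm_omit k \<sigma> \<alpha>) =
      (-1) ^ \<alpha> * (((-1) ^ k * (-1) ^ \<sigma> \<alpha>) * (sign \<sigma> * ((-1) ^ k * (-1) ^ \<alpha>)))"
    using \<alpha> perm_image_le by simp
  then show ?thesis
    by (cases "even \<alpha>"; cases "even k") simp_all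
qed

text \<open>\<open>permute_list\<close> reads its entry at \<alpha> from position \<sigma> \<alpha>
  of xs, so that is the position to be omitted before permuting.\<close>

lemma omit_permute_list:
  assumes "length xs = Suc k"
  shows "omit \<alpha> (permute_list \<sigma> xs) = permute_list (perm_omit k \<sigma> \<alpha>) (omit (\<sigma> \<alpha>) xs)"
proof (rule nth_equalityI)
  show l: "length (omit \<alpha> (permute_list \<sigma> xs)) =
      length (permute_list (perm_omit k \<sigma> \<alpha>) (omit (\<sigma> \<alpha>) xs))"
    using assms \<alpha> perm_image_le by (simp add: length_omit)
  fix a assume "a < length (omit \<alpha> (permute_list \<sigma> xs))"
  then have a: "a < k"
    using assms \<alpha> by (simp add: length_omit)
  then have "skip \<alpha> a < Suc k"
    by (simp add: skip_def)
  then show "omit \<alpha> (permute_list \<sigma> xs) ! a = permute_list (perm_omit k \<sigma> \<alpha>) (omit (\<sigma> \<alpha>) xs) ! a"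
    using permutes_in_image[OF perm_omit_permutes, of a] a assms \<alpha> perm_image_le
      permute_list_nth[of \<sigma> xs "skip \<alpha> a"] \<sigma>
      permute_list_nth[of "perm_omit k \<sigma> \<alpha>" "omit (\<sigma> \<alpha>) xs" a] perm_omit_permutes
    by (simp add: nth_omit length_omit skip_perm_omit)
qed

end

section \<open>Omitting two positions\<close>

text \<open>Here \<beta> is removed first, from k + 2 positions, and \<alpha> from the k + 1 that
  remain. The map (\<beta>, \<alpha>) to (\<alpha>, \<beta> - 1) matches the pairs with \<alpha> <
  \<beta> to the others, and matched terms cancel.\<close>

lemma sum_antisymmetric_faces:
  fixes F :: "nat \<Rightarrow> nat \<Rightarrow> 'a::ab_group_add"
  assumes "\<And>\<alpha> \<beta>. \<alpha> \<le> \<beta> \<Longrightarrow> \<beta> \<le> k \<Longrightarrow> F (Suc \<beta>) \<alpha> = - F \<alpha> \<beta>"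
  shows "(\<Sum>\<beta>\<le>Suc k. \<Sum>\<alpha>\<le>k. F \<beta> \<alpha>) = 0"
proof -
  let ?A = "{(\<beta>, \<alpha>) \<in> {..Suc k} \<times> {..k}. \<alpha> < \<beta>}"
  let ?B = "{(\<beta>, \<alpha>) \<in> {..Suc k} \<times> {..k}. \<beta> \<le> \<alpha>}"
  have fin: "finite ?A" "finite ?B"
    by (auto intro: finite_subset[of _ "{..Suc k} \<times> {..k}"])
  have "(\<Sum>(\<beta>, \<alpha>)\<in>?A. F \<beta> \<alpha>) = (\<Sum>(\<beta>, \<alpha>)\<in>?B. - F \<beta> \<alpha>)"
    by (rule sum.reindex_bij_witness[of _ "\<lambda>(\<beta>, \<alpha>). (Suc \<alpha>, \<beta>)" "\<lambda>(\<beta>, \<alpha>). (\<alpha>, \<beta> - 1)"])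
      (auto simp flip: assms)
  moreover have "(\<Sum>\<beta>\<le>Suc k. \<Sum>\<alpha>\<le>k. F \<beta> \<alpha>) = (\<Sum>(\<beta>, \<alpha>)\<in>?A \<union> ?B. F \<beta> \<alpha>)"
    unfolding sum.cartesian_product by (rule sum.cong) auto
  moreover have "\<dots> = (\<Sum>(\<beta>, \<alpha>)\<in>?A. F \<beta> \<alpha>) + (\<Sum>(\<beta>, \<alpha>)\<in>?B. F \<beta> \<alpha>)"
    by (rule sum.union_disjoint[OF fin]) auto
  ultimately show ?thesis
    by (simp add: case_prod_unfold sum_negf)
qed

text \<open>The cosimplicial identity for coface maps.\<close>

lemma skip_skip: "\<alpha> \<le> \<beta> \<Longrightarrow> skip (Suc \<beta>) (skip \<alpha> a) = skip \<alpha> (skip \<beta> a)"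
  by (auto simp: skip_def)

lemma skip_le: "skip \<alpha> a \<le> Suc a"
  by (simp add: skip_def)

lemma omit_omit:
  assumes "\<alpha> \<le> \<beta>" "Suc \<beta> < length xs"
  shows "omit \<alpha> (omit (Suc \<beta>) xs) = omit \<beta> (omit \<alpha> xs)"
proof (rule nth_equalityI)
  show "length (omit \<alpha> (omit (Suc \<beta>) xs)) = length (omit \<beta> (omit \<alpha> xs))"
    using assms by (simp add: length_omit)
  fix a assume "a < length (omit \<alpha> (omit (Suc \<beta>) xs))"
  then show "omit \<alpha> (omit (Suc \<beta>) xs) ! a = omit \<beta> (omit \<alpha> xs) ! a"
    using assms skip_le[of \<alpha> a] skip_le[of \<beta> a] by (simp add: length_omit nth_omit skip_skip)
qed

lemma permute_list_multi_indices:
  "\<sigma> permutes {..<k} \<Longrightarrow> is \<in> multi_indices l k \<Longrightarrow> permute_list \<sigma> is \<in> multi_indices l k"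
  by (auto simp: multi_indices_def set_permute_list)

section \<open>Skewsymmetry of the values of the differential, and its square\<close>

context quasiconstant_operator
begin

lemma delta_in_mpolys:
  assumes "P \<in> skew_arrays l k"
  shows "delta l D du K k P is \<in> mpolys_in {..<Suc k}"
proof (cases "is \<in> multi_indices l (Suc k)")
  case True
  obtain N where N: "\<And>is. du_vanish N (P is)"
    using du_vanish_array[OF assms] by blast
  have "rename (skip \<alpha>) (P js) \<in> mpolys_in {..<Suc k}" for \<alpha> js
    using skew_arrays_in[OF assms] by (rule mpolys_in_rename) (auto simp: skip_def)
  then show ?thesis
    unfolding delta_eq[OF N True]
    by (intro mpolys_in_sum mpolys_in_minus_one_power dsum_in) auto
qed (simp add: delta_outside)

lemma delta_skew:
  assumes P: "P \<in> skew_arrays l k"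
    and \<sigma>: "\<sigma> permutes {..<Suc k}" and "is": "is \<in> multi_indices l (Suc k)"
  shows "rename \<sigma> (delta l D du K k P (permute_list \<sigma> is)) = of_int (sign \<sigma>) * delta l D du K k P is"
proof -
  obtain N where N: "\<And>is. du_vanish N (P is)"
    using du_vanish_array[OF P] by blast
  have len: "length is = Suc k"
    using "is" by (simp add: multi_indices_def)
  let ?T = "\<lambda>\<alpha>. (-1) ^ \<alpha> * dsum N \<alpha> (is ! \<alpha>) (rename (skip \<alpha>) (P (omit \<alpha> is)))"
  have "rename \<sigma> ((-1) ^ \<alpha> * dsum N \<alpha> (permute_list \<sigma> is ! \<alpha>)
      (rename (skip \<alpha>) (P (omit \<alpha> (permute_list \<sigma> is))))) = of_int (sign \<sigma>) * ?T (\<sigma> \<alpha>)"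
    if \<alpha>: "\<alpha> \<le> k" for \<alpha>
  proof -
    define \<tau> where "\<tau> = perm_omit k \<sigma> \<alpha>"
    define js where "js = omit (\<sigma> \<alpha>) is"
    have js: "js \<in> multi_indices l k"
      unfolding js_def by (rule omit_in_multi_indices[OF "is" perm_image_le[OF \<sigma> \<alpha>]])
    have "rename \<sigma> (rename (skip \<alpha>) (P (permute_list \<tau> js))) =
        rename (skip (\<sigma> \<alpha>)) (rename \<tau> (P (permute_list \<tau> js)))"
      \<comment> \<open>The two composite renamings are compared below k, and the entries of P
        involve no other variables.\<close>
      unfolding rename_rename
      by (rule rename_cong[OF skew_arrays_in[OF P]]) (simp add: \<tau>_def skip_perm_omit[OF \<sigma> \<alpha>])
    also have "\<dots> = of_int (sign \<tau>) * rename (skip (\<sigma> \<alpha>)) (P js)"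
      using perm_omit_permutes[OF \<sigma> \<alpha>] js
      by (simp add: skew_arrays_skew[OF P] additive_of_int_sign[OF additive_rename] flip: \<tau>_def)
    finally have *: "rename \<sigma> (rename (skip \<alpha>) (P (omit \<alpha> (permute_list \<sigma> is)))) =
        of_int (sign \<tau>) * rename (skip (\<sigma> \<alpha>)) (P js)"
      by (simp add: omit_permute_list[OF \<sigma> \<alpha> len] \<tau>_def js_def)
    have "permute_list \<sigma> is ! \<alpha> = is ! \<sigma> \<alpha>"
      using \<sigma> \<alpha> len by (simp add: permute_list_nth)
    then have "rename \<sigma> ((-1) ^ \<alpha> * dsum N \<alpha> (permute_list \<sigma> is ! \<alpha>)
        (rename (skip \<alpha>) (P (omit \<alpha> (permute_list \<sigma> is))))) =
      (-1) ^ \<alpha> * of_int (sign \<tau>) * dsum N (\<sigma> \<alpha>) (is ! \<sigma> \<alpha>) (rename (skip (\<sigma> \<alpha>)) (P js))"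
      by (simp only: additive_minus_one_power[OF additive_rename] rename_dsum *
          additive_of_int_sign[OF additive_dsum] mult.assoc)
    \<comment> \<open>The integer identity \<open>sign_perm_omit\<close>, mapped into the polynomial
      ring.\<close>
    also have "(-1) ^ \<alpha> * of_int (sign \<tau>) =
        (of_int (sign \<sigma>) * (-1) ^ \<sigma> \<alpha> :: (nat, 'v) mpoly)"
      using arg_cong[OF sign_perm_omit[OF \<sigma> \<alpha>], of "of_int :: int \<Rightarrow> (nat, 'v) mpoly"]
      by (simp add: \<tau>_def)
    finally show ?thesis
      by (simp only: js_def mult.assoc)
  qed
  then have "rename \<sigma> (delta l D du K k P (permute_list \<sigma> is)) =
      (\<Sum>\<alpha>\<le>k. of_int (sign \<sigma>) * ?T (\<sigma> \<alpha>))"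
    unfolding delta_eq[OF N permute_list_multi_indices[OF \<sigma> "is"]] rename_sum
    by (intro sum.cong refl) (simp only: atMost_iff)
  also have "\<dots> = of_int (sign \<sigma>) * (\<Sum>\<alpha>\<le>k. ?T (\<sigma> \<alpha>))"
    by (rule sum_distrib_left[symmetric])
  also have "(\<Sum>\<alpha>\<le>k. ?T (\<sigma> \<alpha>)) = (\<Sum>\<alpha>\<le>k. ?T \<alpha>)"
    using permutes_imp_bij[OF \<sigma>] by (intro sum.reindex_bij_betw) (simp add: lessThan_Suc_atMost)
  finally show ?thesis
    unfolding delta_eq[OF N "is"] .
qed

lemma delta_in_skew_arrays:
  "P \<in> skew_arrays l k \<Longrightarrow> delta l D du K k P \<in> skew_arrays l (Suc k)"
  by (rule skew_arraysI) (simp_all add: delta_outside delta_in_mpolys delta_skew)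


text \<open>With a single sum over the pairs (j, n), one exchange of summations settles
  \<open>dsum_commute\<close>.\<close>

lemma dsum_eq:
  "dsum N \<alpha> i p = (\<Sum>t\<in>{1..l} \<times> {..<N}.
    cmap (du (fst t) (snd t)) p * shifted_symbol D \<alpha> (snd t) (K (fst t) i))"
  by (simp add: dsum_def sum.cartesian_product case_prod_beta)

text \<open>The symbols of \<open>K\<close> are quasiconstant, so the outer \<open>du\<close> passes to \<open>p\<close>.\<close>

lemma dsum_dsum:
  assumes i: "i \<in> {1..l}"
  shows "dsum N \<beta> j (dsum N \<alpha> i p) = (\<Sum>t\<in>{1..l} \<times> {..<N}. \<Sum>s\<in>{1..l} \<times> {..<N}.
    cmap (du (fst t) (snd t)) (cmap (du (fst s) (snd s)) p) *
    (shifted_symbol D \<alpha> (snd s) (K (fst s) i) * shifted_symbol D \<beta> (snd t) (K (fst t) j)))"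
  unfolding dsum_eq[of N \<beta>]
proof (rule sum.cong[OF refl])
  fix t assume "t \<in> {1..l} \<times> {..<N}"
  then have t: "fst t \<in> {1..l}"
    by (rule SigmaE) simp
  have "cmap (du (fst t) (snd t)) (dsum N \<alpha> i p) = (\<Sum>s\<in>{1..l} \<times> {..<N}.
      cmap (du (fst t) (snd t)) (cmap (du (fst s) (snd s)) p) *
      shifted_symbol D \<alpha> (snd s) (K (fst s) i))"
    unfolding dsum_eq cmap_du_sum[OF t]
  proof (rule sum.cong[OF refl])
    fix s assume "s \<in> {1..l} \<times> {..<N}"
    then have s: "fst s \<in> {1..l}"
      by (rule SigmaE) simp
    show "cmap (du (fst t) (snd t))
        (cmap (du (fst s) (snd s)) p * shifted_symbol D \<alpha> (snd s) (K (fst s) i)) =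
      cmap (du (fst t) (snd t)) (cmap (du (fst s) (snd s)) p) *
        shifted_symbol D \<alpha> (snd s) (K (fst s) i)"
      unfolding cmap_derivation[OF derivation_du[OF t]] cmap_du_shifted_symbol[OF t s i] by simp
  qed
  then show "cmap (du (fst t) (snd t)) (dsum N \<alpha> i p) * shifted_symbol D \<beta> (snd t) (K (fst t) j) =
      (\<Sum>s\<in>{1..l} \<times> {..<N}. cmap (du (fst t) (snd t)) (cmap (du (fst s) (snd s)) p) *
      (shifted_symbol D \<alpha> (snd s) (K (fst s) i) * shifted_symbol D \<beta> (snd t) (K (fst t) j)))"
    by (simp only: sum_distrib_right mult.assoc)
qed

lemma dsum_commute:
  assumes i: "i \<in> {1..l}" and j: "j \<in> {1..l}"
  shows "dsum N \<beta> j (dsum N \<alpha> i p) = dsum N \<alpha> i (dsum N \<beta> j p)"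
  unfolding dsum_dsum[OF i] dsum_dsum[OF j]
  by (subst sum.swap, intro sum.cong refl, elim SigmaE)
    (simp only: fst_conv snd_conv cmap_du_commute mult.commute)

lemma delta_delta:
  assumes P: "P \<in> skew_arrays l k"
  shows "delta l D du K (Suc k) (delta l D du K k P) = (\<lambda>is. 0)"
proof
  fix "is"
  let ?\<delta>P = "delta l D du K k P"
  obtain M M' where M: "\<And>is. du_vanish M (P is)" and M': "\<And>is. du_vanish M' (?\<delta>P is)"
    using du_vanish_array[OF P] du_vanish_array[OF delta_in_skew_arrays[OF P]] by metis
  \<comment> \<open>The inner and the outer operators must have the same bound, since
    \<open>dsum_commute\<close> exchanges operators with equal N.\<close>
  define N where "N = max M M'"
  have N: "du_vanish N (P is)" and N': "du_vanish N (?\<delta>P is)" for "is"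
    using du_vanish_mono[OF M] du_vanish_mono[OF M'] by (simp_all add: N_def)
  show "delta l D du K (Suc k) ?\<delta>P is = 0"
  proof (cases "is \<in> multi_indices l (Suc (Suc k))")
    case True
    then have len: "length is = Suc (Suc k)"
      by (simp add: multi_indices_def)
    \<comment> \<open>The term that removes \<beta> first and then \<alpha> from the shortened list;
      \<open>skip \<beta> \<alpha>\<close> is the place of the second one in the original
      list.\<close>
    define F where "F \<beta> \<alpha> = (-1) ^ \<beta> * ((-1) ^ \<alpha> * dsum N \<beta> (is ! \<beta>) (dsum N (skip \<beta> \<alpha>) (is ! skip \<beta> \<alpha>)
      (rename (skip \<beta> \<circ> skip \<alpha>) (P (omit \<alpha> (omit \<beta> is))))))" for \<alpha> \<beta>
    have "delta l D du K (Suc k) ?\<delta>P is = (\<Sum>\<beta>\<le>Suc k. \<Sum>\<alpha>\<le>k. F \<beta> \<alpha>)"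
    proof -
      have "dsum N \<beta> (is ! \<beta>) (rename (skip \<beta>) (?\<delta>P (omit \<beta> is))) =
        (\<Sum>\<alpha>\<le>k. (-1) ^ \<alpha> * dsum N \<beta> (is ! \<beta>) (dsum N (skip \<beta> \<alpha>) (is ! skip \<beta> \<alpha>)
          (rename (skip \<beta> \<circ> skip \<alpha>) (P (omit \<alpha> (omit \<beta> is))))))" if "\<beta> \<le> Suc k" for \<beta>
        using that len
        by (simp add: delta_eq[OF N omit_in_multi_indices[OF True that]] rename_sum
            additive_minus_one_power[OF additive_rename] rename_dsum rename_rename nth_omit
            additive.sum[OF additive_dsum] additive_minus_one_power[OF additive_dsum])
      then show ?thesis
        unfolding delta_eq[OF N' True] F_def by (simp add: sum_distrib_left del: sum.atMost_Suc)
    qed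
    also have "\<dots> = 0"
    proof (rule sum_antisymmetric_faces)
      fix \<alpha> \<beta> assume ab: "\<alpha> \<le> \<beta>" "\<beta> \<le> k"
      then have "skip (Suc \<beta>) \<circ> skip \<alpha> = skip \<alpha> \<circ> skip \<beta>"
        by (simp add: fun_eq_iff skip_skip)
      \<comment> \<open>Thus both terms remove the original positions \<alpha> and
        \<open>Suc \<beta>\<close>, in opposite orders, and their signs differ by one factor
        -1.\<close>
      moreover have "skip (Suc \<beta>) \<alpha> = \<alpha>" "skip \<alpha> \<beta> = Suc \<beta>"
        using ab by (simp_all add: skip_def)
      moreover have "is ! \<alpha> \<in> {1..l}" "is ! Suc \<beta> \<in> {1..l}"
        using ab by (intro nth_in_range[OF True]; simp)+
      ultimately show "F (Suc \<beta>) \<alpha> = - F \<alpha> \<beta>"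
        using ab len by (simp add: F_def omit_omit dsum_commute[of "is ! \<alpha>"] mult.left_commute)
    qed
    finally show ?thesis .
  qed (simp add: delta_outside)
qed

end


subsection \<open>Quotient modules\<close>

text \<open>Scalars act on a coset through the union over all its representatives, so that each of
  them must be shown to give the same coset. The module laws then descend along the surjection from
  M.\<close>

lemma
  fixes M (structure)
  assumes M: "Module.module R M" and H: "additive_subgroup H M"
    and smult_H: "\<And>c h. c \<in> carrier R \<Longrightarrow> h \<in> H \<Longrightarrow> c \<odot>\<^bsub>M\<^esub> h \<in> H"
  shows smult_quotient_module: "\<And>c x. c \<in> carrier R \<Longrightarrow> x \<in> carrier M \<Longrightarrow>
      c \<odot>\<^bsub>quotient_module M H\<^esub> (H +> x) = H +> (c \<odot>\<^bsub>M\<^esub> x)"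
    and add_quotient_module: "\<And>x y. x \<in> carrier M \<Longrightarrow> y \<in> carrier M \<Longrightarrow>
      (H +> x) \<oplus>\<^bsub>quotient_module M H\<^esub> (H +> y) = H +> (x \<oplus> y)"
    and carrier_quotient_module: "carrier (quotient_module M H) = (\<lambda>x. H +> x) ` carrier M"
    and module_quotient_module: "Module.module R (quotient_module M H)"
proof -
  interpret M: Module.module R M by (rule M)
  interpret H: abelian_subgroup H M
    by (rule abelian_subgroupI3[OF H]) (rule M.abelian_group_axioms)
  show smult: "c \<odot>\<^bsub>quotient_module M H\<^esub> (H +> x) = H +> (c \<odot>\<^bsub>M\<^esub> x)"
    if c: "c \<in> carrier R" and x: "x \<in> carrier M" for c x
  proof -
    have "H +> (c \<odot> y) = H +> (c \<odot> x)" if y: "y \<in> H +> x" for y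
    proof -
      obtain h where h: "h \<in> H" "y = h \<oplus> x"
        using y by (auto simp: a_r_coset_def')
      then have "c \<odot> y = c \<odot> h \<oplus> c \<odot> x"
        using c x H.a_Hcarr by (simp add: M.smult_r_distr)
      then have "c \<odot> y \<in> H +> (c \<odot> x)"
        using smult_H[OF c h(1)] by (auto simp: a_r_coset_def')
      then show ?thesis
        using c x by (intro H.a_repr_independence' [symmetric] M.smult_closed)
    qed
    moreover have "x \<in> H +> x"
      using x by (rule H.a_rcos_self)
    ultimately have "(\<Union>y\<in>H +> x. H +> (c \<odot> y)) = H +> (c \<odot> x)"
      by (intro SUP_eq_const) blast+
    then show ?thesis
      by (simp add: quotient_module_def)
  qed
  show add: "(H +> x) \<oplus>\<^bsub>quotient_module M H\<^esub> (H +> y) = H +> (x \<oplus> y)"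
    if "x \<in> carrier M" "y \<in> carrier M" for x y
    using H.a_rcos_sum[OF that] by (simp add: quotient_module_def)
  show carrier: "carrier (quotient_module M H) = (\<lambda>x. H +> x) ` carrier M"
    by (auto simp: quotient_module_def A_RCOSETS_def')
  \<comment> \<open>The zero is H itself; in the form of a coset it falls under the rule for
    addition.\<close>
  have zero: "\<zero>\<^bsub>quotient_module M H\<^esub> = H +> \<zero>"
    using M.a_coset_add_zero[OF H.a_subset] by (simp add: quotient_module_def)
  show "Module.module R (quotient_module M H)"
  proof (rule moduleI)
    show "cring R"
      by (rule M.R.cring_axioms)
    show "abelian_group (quotient_module M H)"
    proof (rule abelian_groupI; unfold carrier zero; (elim imageE)?; (simp only: add)?)
      fix X x assume "x \<in> carrier M"
      then show "\<exists>Y\<in>(\<lambda>x. H +> x) ` carrier M. Y \<oplus>\<^bsub>quotient_module M H\<^esub> (H +> x) = H +> \<zero>"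
        by (intro bexI[of _ "H +> (\<ominus> x)"] imageI) (simp_all add: add M.l_neg)
    qed (simp_all add: add M.a_assoc M.a_comm M.a_lcomm)
  qed (unfold carrier, (elim imageE; simp add: add smult M.smult_l_distr M.smult_r_distr M.smult_assoc1)+)
qed


subsection \<open>Injectivity of the total derivative\<close>

lemma lookup_mvar_mult:
  fixes p :: "('x, 'a::comm_ring_1) mpoly"
  shows "Poly_Mapping.lookup (mvar x * p) (Poly_Mapping.single x 1 + m) = Poly_Mapping.lookup p m"
  by (rule additive_eq_on_singles[where p = p])
    (auto intro: additive.intro simp: algebra_simps lookup_add mvar_def mult_single lookup_single when_def)

lemma keys_mvar_mult:
  fixes p :: "('x, 'a::comm_ring_1) mpoly"
  assumes "n \<in> Poly_Mapping.keys (mvar x * p)"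
  obtains m where "m \<in> Poly_Mapping.keys p" "n = Poly_Mapping.single x 1 + m"
  using keys_mult[of "mvar x" p] assms by (auto simp: mvar_def split: if_splits)

text \<open>Among the monomials of \<open>p\<close> of maximal degree in \<open>\<lambda>\<^sub>0\<close>, multiplication by \<open>\<lambda>\<^sub>0\<close> cannot be
  cancelled by the other summands.\<close>

lemma total_D_eq_0_imp_eq_0:
  assumes D: "Modules.additive D" and z: "total_D D (Suc k) p = 0"
  shows "p = 0"
proof (rule ccontr)
  assume "p \<noteq> 0"
  define deg where "deg m = Poly_Mapping.lookup m (0::nat)" for m :: "nat \<Rightarrow>\<^sub>0 nat"
  have "Poly_Mapping.keys p \<noteq> {}"
    using \<open>p \<noteq> 0\<close> by (metis sum_single_keys sum.empty)
  then have "Max (deg ` Poly_Mapping.keys p) \<in> deg ` Poly_Mapping.keys p"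
    by simp
  then obtain m where m: "m \<in> Poly_Mapping.keys p" "deg m = Max (deg ` Poly_Mapping.keys p)"
    by force
  have max: "deg n \<le> deg m" if "n \<in> Poly_Mapping.keys p" for n
    using that by (simp add: m(2))
  define n where "n = Poly_Mapping.single 0 1 + m"
  have deg_n: "deg n = Suc (deg m)"
    by (simp add: n_def deg_def lookup_add)
  have "Poly_Mapping.lookup p n = 0"
    using max[of n] deg_n by (auto simp: in_keys_iff)
  moreover have "Poly_Mapping.lookup (mvar (Suc a) * p) n = 0" for a
  proof (rule ccontr)
    assume "Poly_Mapping.lookup (mvar (Suc a) * p) n \<noteq> 0"
    then obtain m' where m': "m' \<in> Poly_Mapping.keys p" "n = Poly_Mapping.single (Suc a) 1 + m'"
      by (metis in_keys_iff keys_mvar_mult)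
    then have "deg n = deg m'"
      by (simp add: deg_def lookup_add lookup_single)
    then show False
      using max[OF m'(1)] deg_n by simp
  qed
  ultimately have "Poly_Mapping.lookup (total_D D (Suc k) p) n = Poly_Mapping.lookup p m"
    using lookup_mvar_mult[of 0 p m]
    by (simp add: total_D_def lookup_add lookup_cmap[of D, OF additive.zero[OF D]] additive.zero[OF D]
        sum.lessThan_Suc_shift distrib_right sum_distrib_right lookup_sum n_def del: sum.lessThan_Suc)
  then show False
    using z m(1) by (simp add: in_keys_iff)
qed


subsection \<open>Arrays\<close>

lemma skew_arrays_zero: "(\<lambda>is. 0) \<in> skew_arrays l k"
  by (rule skew_arraysI) simp_all

lemma skew_arrays_add:
  "P \<in> skew_arrays l k \<Longrightarrow> Q \<in> skew_arrays l k \<Longrightarrow> (\<lambda>is. P is + Q is) \<in> skew_arrays l k"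
  by (rule skew_arraysI)
    (simp_all add: skew_arrays_outside skew_arrays_in mpolys_in_add rename_add skew_arrays_skew
      algebra_simps)

text \<open>Covers both the action of the field, with c a multiple of 1, and negation, with c =
  -1.\<close>

lemma skew_arrays_mconst:
  "P \<in> skew_arrays l k \<Longrightarrow> (\<lambda>is. mconst c * P is) \<in> skew_arrays l k"
  by (rule skew_arraysI)
    (simp_all add: skew_arrays_outside skew_arrays_in mpolys_in_mult rename_mult skew_arrays_skew
      mult.left_commute)

lemma skew_arrays_uminus:
  assumes "P \<in> skew_arrays l k"
  shows "(\<lambda>is. - P is) \<in> skew_arrays l k"
proof -
  have "- P is = mconst (-1) * P is" for "is"
    by (simp add: mconst_def single_uminus)
  then show ?thesis
    using skew_arrays_mconst[OF assms, of "-1"] by simp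
qed

lemma skew_arrays_diff:
  "P \<in> skew_arrays l k \<Longrightarrow> Q \<in> skew_arrays l k \<Longrightarrow> (\<lambda>is. P is - Q is) \<in> skew_arrays l k"
  using skew_arrays_add[OF _ skew_arrays_uminus, of P l k Q] by simp

lemma array_D_in_skew_arrays:
  assumes D: "Modules.additive D" and P: "P \<in> skew_arrays l k"
  shows "array_D D k P \<in> skew_arrays l k"
  by (rule skew_arraysI)
    (simp_all add: array_D_def skew_arrays_outside[OF P] skew_arrays_in[OF P] total_D_in
      rename_total_D[OF D] skew_arrays_skew[OF P] additive.zero[OF additive_total_D[OF D]]
      additive_of_int_sign[OF additive_total_D[OF D]])

lemma array_D_add:
  assumes "Modules.additive D"
  shows "array_D D k (\<lambda>is. P is + Q is) = (\<lambda>is. array_D D k P is + array_D D k Q is)"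
  by (simp add: array_D_def additive.add[OF additive_total_D[OF assms]])

text \<open>Primitives chosen independently for each entry are unique, so they inherit the symmetry
  of Q. At least one variable is present, as injectivity demands.\<close>

lemma entrywise_exact_imp_exact:
  assumes D: "Modules.additive D" and Q: "Q \<in> skew_arrays l (Suc k)"
    and ex: "\<And>is. is \<in> multi_indices l (Suc k) \<Longrightarrow> Q is \<in> total_D D (Suc k) ` mpolys_in {..<Suc k}"
  shows "Q \<in> exact_arrays l D (Suc k)"
proof -
  have "\<exists>p. p \<in> mpolys_in {..<Suc k} \<and> total_D D (Suc k) p = Q is"
    if "is \<in> multi_indices l (Suc k)" for "is"
    using ex[OF that] by (elim imageE) auto
  then have "\<forall>is\<in>multi_indices l (Suc k).
      \<exists>p. p \<in> mpolys_in {..<Suc k} \<and> total_D D (Suc k) p = Q is" ..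
  from bchoice[OF this] obtain f where f: "is \<in> multi_indices l (Suc k) \<Longrightarrow>
      f is \<in> mpolys_in {..<Suc k} \<and> total_D D (Suc k) (f is) = Q is" for "is"
    by blast
  define R where "R is = (if is \<in> multi_indices l (Suc k) then f is else 0)" for "is"
  have QR: "total_D D (Suc k) (R is) = Q is" for "is"
    using f[of "is"] skew_arrays_outside[OF Q, of "is"]
    by (simp add: R_def additive.zero[OF additive_total_D[OF D]])
  have "R \<in> skew_arrays l (Suc k)"
  proof (rule skew_arraysI)
    fix \<sigma> "is" assume \<sigma>: "\<sigma> permutes {..<Suc k}" and "is": "is \<in> multi_indices l (Suc k)"
    \<comment> \<open>Both terms have the total derivative
      \<open>of_int (sign \<sigma>) * Q is\<close>, the first because renaming by \<sigma> commutes
      with \<open>total_D\<close> and Q is skewsymmetric.\<close>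
    have "total_D D (Suc k) (rename \<sigma> (R (permute_list \<sigma> is)) - of_int (sign \<sigma>) * R is) = 0"
      unfolding additive.diff[OF additive_total_D[OF D]] additive_of_int_sign[OF additive_total_D[OF D]]
        rename_total_D[OF D \<sigma>, symmetric] QR skew_arrays_skew[OF Q \<sigma> "is"]
      by simp
    from total_D_eq_0_imp_eq_0[OF D this]
    show "rename \<sigma> (R (permute_list \<sigma> is)) = of_int (sign \<sigma>) * R is"
      by simp
  next
    show "R is \<in> mpolys_in {..<Suc k}" for "is"
      using f[of "is"] by (simp add: R_def)
  qed (simp add: R_def)
  moreover have "Q = array_D D (Suc k) R"
    by (simp add: array_D_def QR)
  ultimately show ?thesis
    by (simp add: exact_arrays_def)
qed

section \<open>Linearity over the field, and exact arrays as a submodule\<close>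

context quasiconstant_operator
begin

interpretation vector_space scale
  by (rule vector_space_scale)

text \<open>The action of c on coefficients is multiplication by this polynomial, so linearity over
  the field becomes ring algebra.\<close>

abbreviation scalar :: "'f \<Rightarrow> (nat, 'v) mpoly" where
  "scalar c \<equiv> mconst (scale c 1)"

lemma cmap_scale: "cmap (scale c) p = scalar c * p"
proof -
  have "scale c g = scale c 1 * g" for g
    by (subst scale_mult[symmetric]) simp
  then have "scale c = (*) (scale c 1)"
    by (rule ext)
  then have "cmap (scale c) p = cmap ((*) (scale c 1)) p"
    by (rule arg_cong[where f = "\<lambda>f. cmap f p"])
  also have "\<dots> = scalar c * p"
    unfolding mconst_def by (rule mult_map_scale_conv_mult)
  finally show ?thesis .
qed

lemma derivation_scalar:
  assumes "derivation scale d"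
  shows "cmap d (scalar c * p) = scalar c * cmap d p"
proof -
  have "d (scale c 1) = scale c (d 1)"
    using assms by (simp add: derivation_def Vector_Spaces.linear_iff)
  then have "cmap d (scalar c) = 0"
    by (simp add: mconst_def derivation_additive[OF assms] derivation_one[OF assms])
  then show ?thesis
    by (simp add: cmap_derivation[OF assms])
qed

lemma total_D_scalar: "total_D D k (scalar c * p) = scalar c * total_D D k p"
  by (simp add: total_D_def derivation_scalar[OF derivation_D] distrib_left mult.left_commute)

lemma dsum_scalar: "dsum N \<alpha> i (scalar c * p) = scalar c * dsum N \<alpha> i p"
  unfolding dsum_def sum_distrib_left
  by (intro sum.cong refl) (simp only: derivation_scalar[OF derivation_du] mult.assoc)

lemma delta_add:
  assumes P: "P \<in> skew_arrays l k" and Q: "Q \<in> skew_arrays l k"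
  shows "delta l D du K k (\<lambda>is. P is + Q is) = (\<lambda>is. delta l D du K k P is + delta l D du K k Q is)"
proof
  fix "is"
  obtain M M' where M: "\<And>is. du_vanish M (P is)" and M': "\<And>is. du_vanish M' (Q is)"
    using du_vanish_array[OF P] du_vanish_array[OF Q] by metis
  define N where "N = max M M'"
  have N: "du_vanish N (P is)" and N': "du_vanish N (Q is)" for "is"
    using du_vanish_mono[OF M] du_vanish_mono[OF M'] by (simp_all add: N_def)
  show "delta l D du K k (\<lambda>is. P is + Q is) is = delta l D du K k P is + delta l D du K k Q is"
  proof (cases "is \<in> multi_indices l (Suc k)")
    case True
    show ?thesis
      unfolding delta_eq[OF N True] delta_eq[OF N' True] delta_eq[OF du_vanish_add[OF N N'] True]
      by (simp add: rename_add additive.add[OF additive_dsum] distrib_left sum.distrib)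
  qed (simp add: delta_outside)
qed

lemma delta_scalar:
  assumes P: "P \<in> skew_arrays l k"
  shows "delta l D du K k (\<lambda>is. scalar c * P is) = (\<lambda>is. scalar c * delta l D du K k P is)"
proof
  fix "is"
  obtain N where N: "\<And>is. du_vanish N (P is)"
    using du_vanish_array[OF P] by blast
  have N': "du_vanish N (scalar c * P is)" for "is"
    using N[of "is"] by (simp add: du_vanish_def derivation_scalar[OF derivation_du])
  show "delta l D du K k (\<lambda>is. scalar c * P is) is = scalar c * delta l D du K k P is"
  proof (cases "is \<in> multi_indices l (Suc k)")
    case True
    show ?thesis
      unfolding delta_eq[OF N True] delta_eq[OF N' True]
      by (simp add: rename_mult dsum_scalar sum_distrib_left mult.left_commute)
  qed (simp add: delta_outside)
qed

lemma exact_arrays_subset: "exact_arrays l D k \<subseteq> skew_arrays l k"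
  by (auto simp: exact_arrays_def intro: array_D_in_skew_arrays[OF additive_D])

lemma exact_arrays_zero: "(\<lambda>is. 0) \<in> exact_arrays l D k"
proof -
  have "(\<lambda>is. 0) = array_D D k (\<lambda>is. 0)"
    by (simp add: array_D_def additive.zero[OF additive_total_D[OF additive_D]])
  then show ?thesis
    unfolding exact_arrays_def using skew_arrays_zero by blast
qed

lemma exact_arrays_add:
  "P \<in> exact_arrays l D k \<Longrightarrow> Q \<in> exact_arrays l D k \<Longrightarrow> (\<lambda>is. P is + Q is) \<in> exact_arrays l D k"
  unfolding exact_arrays_def
  by (auto intro: image_eqI[OF _ skew_arrays_add] simp: array_D_add[OF additive_D])

lemma exact_arrays_scalar:
  assumes "P \<in> exact_arrays l D k"
  shows "(\<lambda>is. scalar c * P is) \<in> exact_arrays l D k"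
proof -
  obtain R where R: "R \<in> skew_arrays l k" "P = array_D D k R"
    using assms by (auto simp: exact_arrays_def)
  then have "(\<lambda>is. scalar c * P is) = array_D D k (\<lambda>is. scalar c * R is)"
    by (simp add: array_D_def total_D_scalar)
  then show ?thesis
    using skew_arrays_mconst[OF R(1)] by (auto simp: exact_arrays_def)
qed

lemma exact_arrays_uminus:
  assumes "P \<in> exact_arrays l D k"
  shows "(\<lambda>is. - P is) \<in> exact_arrays l D k"
proof -
  have "scalar (-1) = -1"
    by (simp add: mconst_def single_uminus)
  then show ?thesis
    using exact_arrays_scalar[OF assms, of "-1"] by simp
qed


subsection \<open>The complexes\<close>

lemma Omega_tilde_simps:
  "carrier (Omega_tilde l scale k) = skew_arrays l k"
  "\<zero>\<^bsub>Omega_tilde l scale k\<^esub> = (\<lambda>is. 0)"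
  "P \<oplus>\<^bsub>Omega_tilde l scale k\<^esub> Q = (\<lambda>is. P is + Q is)"
  "c \<odot>\<^bsub>Omega_tilde l scale k\<^esub> P = (\<lambda>is. scalar c * P is)"
  by (simp_all add: Omega_tilde_def cmap_scale)

lemma scalar_simps:
  "scalar (a + b) = scalar a + scalar b" "scalar (a * b) = scalar a * scalar b" "scalar 1 = 1"
proof -
  have "scale (a * b) 1 = scale a 1 * scale b 1"
    by (simp flip: scale_mult)
  then show "scalar (a * b) = scalar a * scalar b"
    by (simp add: mconst_def mult_single)
qed (simp_all add: mconst_def scale_left_distrib single_add)

lemma module_Omega_tilde: "Module.module ring_of_type_algebra (Omega_tilde l scale k)"
proof (rule moduleI)
  show "cring (ring_of_type_algebra :: 'f ring)"
    by (rule cring_from_type_algebra)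
  show "abelian_group (Omega_tilde l scale k)"
  proof (rule abelian_groupI)
    fix P assume "P \<in> carrier (Omega_tilde l scale k)"
    then show "\<exists>Q\<in>carrier (Omega_tilde l scale k).
        Q \<oplus>\<^bsub>Omega_tilde l scale k\<^esub> P = \<zero>\<^bsub>Omega_tilde l scale k\<^esub>"
      by (intro bexI[of _ "\<lambda>is. - P is"]) (simp_all add: Omega_tilde_simps skew_arrays_uminus)
  qed (simp_all add: Omega_tilde_simps skew_arrays_zero skew_arrays_add add_ac)
qed (simp_all add: Omega_tilde_simps skew_arrays_mconst ring_of_type_algebra_def[where ?'a = 'f]
    scalar_simps distrib_right distrib_left mult.assoc mconst_one)

lemma a_inv_Omega_tilde:
  assumes "P \<in> skew_arrays l k"
  shows "\<ominus>\<^bsub>Omega_tilde l scale k\<^esub> P = (\<lambda>is. - P is)"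
  by (rule abelian_group.minus_equality[OF Module.module.axioms(2)[OF module_Omega_tilde]])
    (use assms in \<open>simp_all add: Omega_tilde_simps skew_arrays_uminus\<close>)

lemma additive_subgroup_exact: "additive_subgroup (exact_arrays l D k) (Omega_tilde l scale k)"
proof (rule additive_subgroupI, rule group.subgroupI)
  show "group (add_monoid (Omega_tilde l scale k))"
    by (rule abelian_group.a_group[OF Module.module.axioms(2)[OF module_Omega_tilde]])
  show "exact_arrays l D k \<subseteq> carrier (add_monoid (Omega_tilde l scale k))"
    using exact_arrays_subset by (simp add: Omega_tilde_simps)
  show "exact_arrays l D k \<noteq> {}"
    using exact_arrays_zero by blast
  fix P assume P: "P \<in> exact_arrays l D k"
  then have "P \<in> skew_arrays l k"
    using exact_arrays_subset by blast
  then show "inv\<^bsub>add_monoid (Omega_tilde l scale k)\<^esub> P \<in> exact_arrays l D k"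
    using exact_arrays_uminus[OF P] by (simp add: a_inv_Omega_tilde flip: a_inv_def)
  fix Q assume "Q \<in> exact_arrays l D k"
  then show "P \<otimes>\<^bsub>add_monoid (Omega_tilde l scale k)\<^esub> Q \<in> exact_arrays l D k"
    using exact_arrays_add[OF P] by (simp add: Omega_tilde_simps)
qed

lemma exact_smult_closed:
  "P \<in> exact_arrays l D k \<Longrightarrow> c \<odot>\<^bsub>Omega_tilde l scale k\<^esub> P \<in> exact_arrays l D k"
  by (simp add: Omega_tilde_simps exact_arrays_scalar)

lemma carrier_scalars: "c \<in> carrier ring_of_type_algebra"
  by (simp add: ring_of_type_algebra_def)

lemmas Omega_quotient = module_Omega_tilde additive_subgroup_exact exact_smult_closed

lemma module_Omega: "Module.module ring_of_type_algebra (Omega l scale D k)"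
  unfolding Omega_def by (rule module_quotient_module[OF Omega_quotient])

lemma carrier_Omega: "carrier (Omega l scale D k) = Omega_proj l scale D k ` skew_arrays l k"
  using carrier_quotient_module[OF Omega_quotient]
  by (simp add: Omega_def Omega_proj_def Omega_tilde_simps(1))

lemma Omega_proj_add:
  "P \<in> skew_arrays l k \<Longrightarrow> Q \<in> skew_arrays l k \<Longrightarrow>
    Omega_proj l scale D k (\<lambda>is. P is + Q is) =
    Omega_proj l scale D k P \<oplus>\<^bsub>Omega l scale D k\<^esub> Omega_proj l scale D k Q"
  using add_quotient_module[OF Omega_quotient, of k P Q]
  by (simp add: Omega_def Omega_proj_def Omega_tilde_simps)

lemma Omega_proj_smult:
  "P \<in> skew_arrays l k \<Longrightarrow>
    Omega_proj l scale D k (\<lambda>is. scalar c * P is) = c \<odot>\<^bsub>Omega l scale D k\<^esub> Omega_proj l scale D k P"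
  using smult_quotient_module[OF Omega_quotient carrier_scalars, of k P c]
  by (simp add: Omega_def Omega_proj_def Omega_tilde_simps)

lemma mem_Omega_proj:
  "Q \<in> Omega_proj l scale D k P \<longleftrightarrow> (\<exists>E\<in>exact_arrays l D k. Q = (\<lambda>is. E is + P is))"
  by (auto simp: Omega_proj_def a_r_coset_def' Omega_tilde_simps)

lemma zero_Omega: "\<zero>\<^bsub>Omega l scale D k\<^esub> = Omega_proj l scale D k (\<lambda>is. 0)"
  by (auto simp: mem_Omega_proj Omega_def quotient_module_def)

text \<open>\<open>delta_Omega\<close> is a set of solutions of congruences; this identifies it with
  the map of cosets induced by \<open>delta\<close>, so that every property of the quotient complex
  descends from \<open>Omega_tilde\<close>.\<close>

lemma delta_Omega_proj:
  assumes P: "P \<in> skew_arrays l k"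
  shows "delta_Omega l D du K k (Omega_proj l scale D k P) =
    Omega_proj l scale D (Suc k) (delta l D du K k P)"
proof (intro equalityI subsetI)
  fix Q assume "Q \<in> delta_Omega l D du K k (Omega_proj l scale D k P)"
  then obtain P' where Q: "Q \<in> skew_arrays l (Suc k)" and P': "P' \<in> Omega_proj l scale D k P"
    and ex: "\<forall>is\<in>multi_indices l (Suc k).
      Q is - delta l D du K k P' is \<in> total_D D (Suc k) ` mpolys_in {..<Suc k}"
    unfolding delta_Omega_def by blast
  obtain R where R: "R \<in> skew_arrays l k" and P'_eq: "P' = (\<lambda>is. array_D D k R is + P is)"
    using P' by (auto simp: mem_Omega_proj exact_arrays_def)
  have "P' \<in> skew_arrays l k"
    unfolding P'_eq by (intro skew_arrays_add array_D_in_skew_arrays[OF additive_D] R P)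
  then have "(\<lambda>is. Q is - delta l D du K k P' is) \<in> exact_arrays l D (Suc k)"
    using ex by (intro entrywise_exact_imp_exact[OF additive_D] skew_arrays_diff Q
        delta_in_skew_arrays) simp_all
  moreover have "array_D D (Suc k) (delta l D du K k R) \<in> exact_arrays l D (Suc k)"
    unfolding exact_arrays_def by (intro imageI delta_in_skew_arrays R)
  ultimately have "(\<lambda>is. Q is - delta l D du K k P' is + array_D D (Suc k) (delta l D du K k R) is)
      \<in> exact_arrays l D (Suc k)"
    by (rule exact_arrays_add)
  \<comment> \<open>As \<open>delta\<close> commutes with the total derivative, another
    representative changes the value only by an exact array.\<close>
  moreover have "delta l D du K k P' =
      (\<lambda>is. array_D D (Suc k) (delta l D du K k R) is + delta l D du K k P is)"
    unfolding P'_eq delta_add[OF array_D_in_skew_arrays[OF additive_D R] P] delta_array_D[OF R] ..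
  ultimately show "Q \<in> Omega_proj l scale D (Suc k) (delta l D du K k P)"
    unfolding mem_Omega_proj by (intro bexI) auto
next
  fix Q assume "Q \<in> Omega_proj l scale D (Suc k) (delta l D du K k P)"
  then obtain R where R: "R \<in> skew_arrays l (Suc k)"
    and Q: "Q = (\<lambda>is. array_D D (Suc k) R is + delta l D du K k P is)"
    by (auto simp: mem_Omega_proj exact_arrays_def)
  have "Q \<in> skew_arrays l (Suc k)"
    unfolding Q by (intro skew_arrays_add array_D_in_skew_arrays[OF additive_D] R delta_in_skew_arrays P)
  \<comment> \<open>P itself serves as the representative, and R supplies the primitive of each
    entry.\<close>
  moreover have "P \<in> Omega_proj l scale D k P"
    unfolding mem_Omega_proj by (rule bexI[OF _ exact_arrays_zero]) simp
  moreover have "Q is - delta l D du K k P is \<in> total_D D (Suc k) ` mpolys_in {..<Suc k}" for "is"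
    using skew_arrays_in[OF R] by (simp add: Q array_D_def)
  ultimately show "Q \<in> delta_Omega l D du K k (Omega_proj l scale D k P)"
    unfolding delta_Omega_def by blast
qed

lemma module_map_delta:
  "module_map ring_of_type_algebra (Omega_tilde l scale k) (Omega_tilde l scale (Suc k)) (delta l D du K k)"
  by (simp add: module_map_def Omega_tilde_simps delta_in_skew_arrays delta_add delta_scalar)

lemma cochain_complex_Omega_tilde:
  "cochain_complex ring_of_type_algebra (Omega_tilde l scale) (delta l D du K)"
  by (simp add: cochain_complex_def module_Omega_tilde module_map_delta)
    (simp add: Omega_tilde_simps delta_delta)

lemma module_map_Omega_proj:
  "module_map ring_of_type_algebra (Omega_tilde l scale k) (Omega l scale D k) (Omega_proj l scale D k)"
  by (simp add: module_map_def Omega_tilde_simps carrier_Omega Omega_proj_add Omega_proj_smult)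

text \<open>Every class is the projection of an array, and the projection is linear, so linearity
  descends from \<open>delta\<close>.\<close>

lemma module_map_delta_Omega:
  "module_map ring_of_type_algebra (Omega l scale D k) (Omega l scale D (Suc k)) (delta_Omega l D du K k)"
  by (simp add: module_map_def carrier_Omega Pi_iff delta_Omega_proj delta_in_skew_arrays
      delta_add delta_scalar skew_arrays_add skew_arrays_mconst
      flip: Omega_proj_add Omega_proj_smult)

lemma cochain_complex_Omega:
  "cochain_complex ring_of_type_algebra (Omega l scale D) (delta_Omega l D du K)"
  by (simp add: cochain_complex_def module_Omega module_map_delta_Omega)
    (simp add: carrier_Omega delta_Omega_proj delta_in_skew_arrays delta_delta zero_Omega)

lemma complex_hom_Omega_proj:
  "complex_hom ring_of_type_algebra (Omega_tilde l scale) (delta l D du K)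
    (Omega l scale D) (delta_Omega l D du K) (Omega_proj l scale D)"
  by (simp add: complex_hom_def cochain_complex_Omega_tilde cochain_complex_Omega module_map_Omega_proj)
    (simp add: Omega_tilde_simps delta_Omega_proj)

end

theorem proposition10p8:
  fixes l :: nat
    and scale :: "'f::field_char_0 \<Rightarrow> 'v::comm_ring_1 \<Rightarrow> 'v"
    and D :: "'v \<Rightarrow> 'v"
    and du :: "nat \<Rightarrow> nat \<Rightarrow> 'v \<Rightarrow> 'v"
    and \<iota> :: "(nat \<times> nat, 'f) mpoly \<Rightarrow> 'v"
    and K :: "nat \<Rightarrow> nat \<Rightarrow> 'v poly"
  assumes "diff_functions_extension l scale D du \<iota>"
    and "\<forall>i\<in>{1..l}. \<forall>j\<in>{1..l}. \<forall>m. coeff (K i j) m \<in> quasiconstants l du"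
  shows "cochain_complex ring_of_type_algebra (Omega_tilde l scale) (delta l D du K) \<and>
    (\<forall>k. \<forall>P\<in>carrier (Omega_tilde l scale k).
       delta l D du K k (array_D D k P) = array_D D (Suc k) (delta l D du K k P)) \<and>
    complex_hom ring_of_type_algebra
      (Omega_tilde l scale) (delta l D du K)
      (Omega l scale D) (delta_Omega l D du K)
      (Omega_proj l scale D)"
proof -
  interpret diff_functions_extension l scale D du \<iota>
    by (rule assms(1))
  interpret quasiconstant_operator l scale D du K
    by unfold_locales (use assms(2) in blast)
  show ?thesis
    using cochain_complex_Omega_tilde delta_array_D complex_hom_Omega_proj
    by (simp add: Omega_tilde_simps(1))
qed

end
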